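(* Let $$H(X_1,\ldots,X_n):=\sum_{k=1}^\infty\sum_{|\alpha|=k}\overline{a}_\alpha X_\alpha^*+a_0I+\sum_{k=1}^\infty\sum_{|\alpha|=k}a_\alpha X_\alpha,\quad a_\alpha\in\mathbb{C},$$ be a selfadjoint harmonic function on $[B(\mathcal{X})^n]_{<1}$ such that $\|H(X_1,\ldots,X_n)\|\leq1$ for any $(X_1,\ldots,X_n)\in[B(\mathcal{X})^n]_{<1}$ and any Hilbert space $\mathcal{X}$. Let $\mathcal{H}$ denote an arbitrary Hilbert space. Then (i) $\left(\sum_{|\alpha|=k}|a_\alpha|^2\right)^{1/2}\leq1-|a_0|$ for any $k=1,2,\ldots$; (ii) $\sum_{k=0}^\infty\left\|\sum_{|\alpha|=k}|a_\alpha|T_\alpha\right\|\leq1$ for any $(T_1,\ldots,T_n)\in[B(\mathcal{H})^n]_{1/2}$; (iii) $\sum_{k=1}^\infty\left\|\sum_{|\alpha|=k}|\overline{a}_\alpha|T_\alpha^*\right\|+|a_0|+\sum_{k=1}^\infty\left\|\sum_{|\alpha|=k}|a_\alpha|T_\alpha\right\|\leq1$ for any $(T_1,\ldots,T_n)\in[B(\mathcal{H})^n]_{1/3}$. In particular, if $r_1,\ldots,r_n\geq0$, then (iv) $\sum_{k=0}^\infty\left(\sum_{|\alpha|=k}|a_\alpha|r_\alpha\right)\leq1$ if $\|(r_1,\ldots,r_n)\|_2\leq\frac12$; (v) $|a_0|+2\sum_{k=1}^\infty\left(\sum_{|\alpha|=k}|a_\alpha|r_\alpha\right)\leq1$ if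 $\|(r_1,\ldots,r_n)\|_2\leq\frac13$.
   Context: $\mathbb{F}_n^+$ is the unital free semigroup on $g_1,\dots,g_n$ with identity $g_0$; $|g_{i_1}\cdots g_{i_k}|=k$, $|g_0|=0$; for $\alpha=g_{i_1}\cdots g_{i_k}$, $T_\alpha:=T_{i_1}\cdots T_{i_k}$, $T_{g_0}:=I$ (similarly for scalars), $T_\alpha^*:=(T_\alpha)^*$; $a_0:=a_{g_0}$. $[B(\mathcal{X})^n]_{<1}:=\{(X_1,\ldots,X_n)\in B(\mathcal{X})^n:\|X_1X_1^*+\cdots+X_nX_n^*\|<1\}$ and $[B(\mathcal{H})^n]_r:=\{(T_1,\ldots,T_n):\|T_1T_1^*+\cdots+T_nT_n^*\|^{1/2}\le r\}$. A (universal) holomorphic function on $[B(\mathcal{X})^n]_{<1}$ with scalar coefficients is $F(X_1,\ldots,X_n)=\sum_{k=0}^\infty\left(\sum_{|\alpha|=k}c_\alpha X_\alpha\right)$, $c_\alpha\in\mathbb{C}$, where the series in $k$ converges in norm for every Hilbert space $\mathcal{X}$ and every $(X_1,\ldots,X_n)\in[B(\mathcal{X})^n]_{<1}$. A selfadjoint harmonic function on $[B(\mathcal{X})^n]_{<1}$ is a function $G$ of the form $G(X_1,\ldots,X_n)=\mathrm{Re}\,F(X_1,\ldots,X_n)$ with $F$ such a holomorphic function, where $\mathrm{Re}\,A=\frac12(A+A^* )$. $\|\cdot\|_2$ is the Euclidean norm. *)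

theory Defs
  imports
    "HOL-Analysis.Analysis"
    "HOL-Algebra.Algebraic_Closure_Type"
    "HOL-Library.Infinite_Typeclass"
begin

text \<open>Hilbert spaces have to be quantified inside hypotheses, so they are carrier-based:
  modules in the sense of HOL-Algebra over the ring of all complex numbers, together with an
  inner product, linear in the first argument. (As for every HOL-Algebra module, the record
  fields for ring multiplication and unit are unused.)\<close>

abbreviation complex_ring :: "complex ring" where
  "complex_ring \<equiv> ring_of_type_algebra"

record 'x hilbert = "(complex, 'x) module" +
  ip :: "'x \<Rightarrow> 'x \<Rightarrow> complex"

definition hnorm :: "'x hilbert \<Rightarrow> 'x \<Rightarrow> real" where
  "hnorm V x = sqrt (Re (ip V x x))"

locale complex_hilbert_space = module complex_ring V for V :: "'x hilbert" (structure) +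
  assumes ip_add_left: "\<lbrakk>x \<in> carrier V; y \<in> carrier V; z \<in> carrier V\<rbrakk>
      \<Longrightarrow> ip V (x \<oplus> y) z = ip V x z + ip V y z"
    and ip_smult_left: "\<lbrakk>x \<in> carrier V; y \<in> carrier V\<rbrakk> \<Longrightarrow> ip V (c \<odot> x) y = c * ip V x y"
    and ip_cnj: "\<lbrakk>x \<in> carrier V; y \<in> carrier V\<rbrakk> \<Longrightarrow> ip V y x = cnj (ip V x y)"
    and ip_nonneg: "x \<in> carrier V \<Longrightarrow> 0 \<le> Re (ip V x x)"
    and ip_definite: "\<lbrakk>x \<in> carrier V; ip V x x = 0\<rbrakk> \<Longrightarrow> x = \<zero>"
    and complete: "\<lbrakk>\<And>m. s m \<in> carrier V;
        \<And>e. e > 0 \<Longrightarrow> \<exists>N. \<forall>m\<ge>N. \<forall>k\<ge>N. hnorm V (s m \<ominus> s k) < e\<rbrakk>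
      \<Longrightarrow> \<exists>x\<in>carrier V. (\<lambda>m. hnorm V (s m \<ominus> x)) \<longlonglongrightarrow> 0"

text \<open>Operators are functions on the type \<^typ>\<open>'x\<close>; only their values on the carrier matter,
  and equality of operators means equality on the carrier.\<close>

definition bounded_op :: "'x hilbert \<Rightarrow> ('x \<Rightarrow> 'x) \<Rightarrow> bool" where
  "bounded_op V T \<longleftrightarrow>
     T \<in> carrier V \<rightarrow> carrier V \<and>
     (\<forall>x\<in>carrier V. \<forall>y\<in>carrier V. T (x \<oplus>\<^bsub>V\<^esub> y) = T x \<oplus>\<^bsub>V\<^esub> T y) \<and>
     (\<forall>c. \<forall>x\<in>carrier V. T (c \<odot>\<^bsub>V\<^esub> x) = c \<odot>\<^bsub>V\<^esub> T x) \<and>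
     (\<exists>B. \<forall>x\<in>carrier V. hnorm V (T x) \<le> B * hnorm V x)"

definition opnorm :: "'x hilbert \<Rightarrow> ('x \<Rightarrow> 'x) \<Rightarrow> real" where
  "opnorm V T = (SUP x\<in>{x \<in> carrier V. hnorm V x \<le> 1}. hnorm V (T x))"

definition adj :: "'x hilbert \<Rightarrow> ('x \<Rightarrow> 'x) \<Rightarrow> 'x \<Rightarrow> 'x" where
  "adj V T y = (THE z. z \<in> carrier V \<and> (\<forall>x\<in>carrier V. ip V (T x) y = ip V x z))"

definition re_op :: "'x hilbert \<Rightarrow> ('x \<Rightarrow> 'x) \<Rightarrow> 'x \<Rightarrow> 'x" where
  "re_op V T v = (1/2) \<odot>\<^bsub>V\<^esub> (T v \<oplus>\<^bsub>V\<^esub> adj V T v)"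

text \<open>The free semigroup on \<open>n\<close> generators is the type \<^typ>\<open>'n list\<close> with
  \<open>n = CARD('n)\<close>; its identity is \<^term>\<open>[]\<close>.\<close>

primrec word_op :: "('n \<Rightarrow> 'x \<Rightarrow> 'x) \<Rightarrow> 'n list \<Rightarrow> 'x \<Rightarrow> 'x" where
  "word_op T [] = id"
| "word_op T (i # \<alpha>) = T i \<circ> word_op T \<alpha>"

definition words :: "nat \<Rightarrow> 'n list set" where
  "words k = {\<alpha>. length \<alpha> = k}"

definition hom_part ::
  "'x hilbert \<Rightarrow> ('n::finite list \<Rightarrow> complex) \<Rightarrow> ('n \<Rightarrow> 'x \<Rightarrow> 'x) \<Rightarrow> nat \<Rightarrow> 'x \<Rightarrow> 'x" where
  "hom_part V c T k v = (\<Oplus>\<^bsub>V\<^esub>\<alpha>\<in>words k. c \<alpha> \<odot>\<^bsub>V\<^esub> word_op T \<alpha> v)"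

definition adj_hom_part ::
  "'x hilbert \<Rightarrow> ('n::finite list \<Rightarrow> complex) \<Rightarrow> ('n \<Rightarrow> 'x \<Rightarrow> 'x) \<Rightarrow> nat \<Rightarrow> 'x \<Rightarrow> 'x" where
  "adj_hom_part V c T k v = (\<Oplus>\<^bsub>V\<^esub>\<alpha>\<in>words k. c \<alpha> \<odot>\<^bsub>V\<^esub> adj V (word_op T \<alpha>) v)"

definition row_square :: "'x hilbert \<Rightarrow> ('n::finite \<Rightarrow> 'x \<Rightarrow> 'x) \<Rightarrow> 'x \<Rightarrow> 'x" where
  "row_square V T v = (\<Oplus>\<^bsub>V\<^esub>i\<in>UNIV. T i (adj V (T i) v))"

definition row_ball :: "'x hilbert \<Rightarrow> ('n::finite \<Rightarrow> 'x \<Rightarrow> 'x) set" where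
  "row_ball V = {T. (\<forall>i. bounded_op V (T i)) \<and> opnorm V (row_square V T) < 1}"

definition row_cball :: "'x hilbert \<Rightarrow> real \<Rightarrow> ('n::finite \<Rightarrow> 'x \<Rightarrow> 'x) set" where
  "row_cball V r = {T. (\<forall>i. bounded_op V (T i)) \<and> sqrt (opnorm V (row_square V T)) \<le> r}"

text \<open>Norm convergence of a series of operators to the bounded operator \<open>S\<close>.\<close>

definition op_sums :: "'x hilbert \<Rightarrow> (nat \<Rightarrow> 'x \<Rightarrow> 'x) \<Rightarrow> ('x \<Rightarrow> 'x) \<Rightarrow> bool" where
  "op_sums V f S \<longleftrightarrow> bounded_op V S \<and>
     (\<lambda>N. opnorm V (\<lambda>v. (\<Oplus>\<^bsub>V\<^esub>k\<in>{..<N}. f k v) \<ominus>\<^bsub>V\<^esub> S v)) \<longlonglongrightarrow> 0"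

text \<open>A function on the open operator balls of all Hilbert spaces with carrier in the type
  \<^typ>\<open>'x\<close>, which plays the role of the universe of Hilbert spaces.\<close>

type_synonym ('x, 'n) op_function = "'x hilbert \<Rightarrow> ('n \<Rightarrow> 'x \<Rightarrow> 'x) \<Rightarrow> 'x \<Rightarrow> 'x"

definition free_holomorphic :: "('x, 'n::finite) op_function \<Rightarrow> bool" where
  "free_holomorphic F \<longleftrightarrow> (\<exists>c. \<forall>V. complex_hilbert_space V \<longrightarrow>
     (\<forall>T\<in>row_ball V. op_sums V (hom_part V c T) (F V T)))"

definition selfadjoint_harmonic :: "('x, 'n::finite) op_function \<Rightarrow> bool" where
  "selfadjoint_harmonic G \<longleftrightarrow> (\<exists>F. free_holomorphic F \<and>
     (\<forall>V. complex_hilbert_space V \<longrightarrow>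
       (\<forall>T\<in>row_ball V. \<forall>v\<in>carrier V. G V T v = re_op V (F V T) v)))"

text \<open>The function \<open>H\<close> is given by the two-sided series with coefficients \<open>cnj (a \<alpha>)\<close> and \<open>a \<alpha>\<close>; both
  one-sided series are required to converge in norm.\<close>

definition has_harmonic_expansion ::
  "('x, 'n::finite) op_function \<Rightarrow> ('n list \<Rightarrow> complex) \<Rightarrow> bool" where
  "has_harmonic_expansion H a \<longleftrightarrow> (\<forall>V. complex_hilbert_space V \<longrightarrow>
     (\<forall>T\<in>row_ball V. \<exists>A B.
        op_sums V (\<lambda>k. adj_hom_part V (\<lambda>\<alpha>. cnj (a \<alpha>)) T (Suc k)) B \<and>
        op_sums V (\<lambda>k. hom_part V a T (Suc k)) A \<and>
        (\<forall>v\<in>carrier V. H V T v = B v \<oplus>\<^bsub>V\<^esub> a [] \<odot>\<^bsub>V\<^esub> v \<oplus>\<^bsub>V\<^esub> A v)))"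

definition word_scalar :: "real ^ 'n \<Rightarrow> 'n list \<Rightarrow> real" where
  "word_scalar r \<alpha> = prod_list (map (\<lambda>i. r $ i) \<alpha>)"

end

theory Submission
  imports Defs
begin

text \<open>The coefficient bound only needs the quadratic form of \<open>H\<close> at one tuple: on the Fock space
  truncated to words of length at most \<open>k\<close>, the scaled left creation operators \<open>r S\<^sub>i\<close> form a strict
  row contraction, and for a vector \<open>y\<close> of degree \<open>k\<close> orthogonality of degrees leaves only \<open>a []\<close> and
  the coefficients of degree \<open>k\<close> in \<open>\<langle>H(rS)(1 + y), 1 + y\<rangle>\<close>. The constant term is real because \<open>H\<close> is
  a real part. For the Bohr-type sums, iterating \<open>\<Sum>\<^sub>i \<parallel>T\<^sub>i\<^sup>* v\<parallel>\<^sup>2 \<le> r\<^sup>2 \<parallel>v\<parallel>\<^sup>2\<close> over words and applying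
  Cauchy-Schwarz bounds the norm of a homogeneous polynomial of degree \<open>k\<close> by \<open>r ^ k\<close> times the
  Euclidean norm of its coefficients, so that geometric series finish the proof.\<close>

text \<open>The hypotheses speak only of Hilbert spaces inside the type
  \<open>'u \<Rightarrow> complex\<close>, so the test space has to be realised there. Each degree
  \<open>k\<close> asks for finitely many coordinates, which an infinite \<open>'u\<close> supplies.
  Cutting at length \<open>k\<close> loses nothing, since longer words are orthogonal to the test
  vector, and it makes norms, adjoints and completeness a matter of finite sums. Let
  \<open>S\<close> be the Euclidean norm of the coefficients of degree \<open>k\<close> and
  \<open>y\<close> their normalisation. A vector \<open>p * 1 + q * y\<close> with real weights
  gives \<open>a [] * (p^2 + q^2) + 2 * p * q * r^k * S\<close> against \<open>p^2 + q^2\<close>; as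
  \<open>2 * p * q\<close> reaches \<open>p^2 + q^2\<close> only at \<open>p = q\<close>, equal
  weights are optimal. Both signs of \<open>y\<close> together give
  \<open>cmod (a []) + r^k * S \<le> 1\<close>, but only for real \<open>a []\<close>: for imaginary
  \<open>a []\<close> the same test would merely bound \<open>(cmod (a []))^2 + (r^k * S)^2\<close>
  by 1. The ball being open forces \<open>r < 1\<close>, so the coefficient bound itself is a
  limit.\<close>

lemma carrier_complex_ring [simp]: "carrier complex_ring = UNIV"
  by (simp add: ring_of_type_algebra_def)

lemma complex_ring_simps [simp]:
  "x \<oplus>\<^bsub>complex_ring\<^esub> y = x + y" "x \<otimes>\<^bsub>complex_ring\<^esub> y = x * y"
  "\<one>\<^bsub>complex_ring\<^esub> = 1" "\<zero>\<^bsub>complex_ring\<^esub> = 0"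
  by (simp_all add: ring_of_type_algebra_def)

lemma finite_words [simp]: "finite (words k :: 'n::finite list set)"
  unfolding words_def using finite_lists_length_eq[of "UNIV :: 'n set" k] by simp

lemma words_0 [simp]: "words 0 = {[]}"
  by (auto simp: words_def)

text \<open>Splits off the first letter, the one that \<open>word_op\<close> applies last; every
  induction on the degree runs through this.\<close>

lemma sum_words_Suc:
  fixes f :: "'n::finite list \<Rightarrow> 'b::comm_monoid_add"
  shows "(\<Sum>\<alpha>\<in>words (Suc k). f \<alpha>) = (\<Sum>i\<in>UNIV. \<Sum>\<beta>\<in>words k. f (i # \<beta>))"
proof -
  have *: "words (Suc k) = (\<lambda>(i, \<beta>). i # \<beta>) ` (UNIV \<times> (words k :: 'n list set))"
    by (auto simp: words_def length_Suc_conv image_iff)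
  have "inj_on (\<lambda>(i, \<beta>). i # \<beta>) (UNIV \<times> (words k :: 'n list set))"
    by (auto simp: inj_on_def)
  then show ?thesis
    unfolding * by (simp add: sum.reindex sum.cartesian_product case_prod_unfold)
qed

lemma (in abelian_group) minus_add_cancel [simp]:
  "x \<in> carrier G \<Longrightarrow> y \<in> carrier G \<Longrightarrow> (x \<ominus> y) \<oplus> y = x"
  by (simp add: minus_eq a_assoc l_neg)

text \<open>Cancels one factor in estimates of the form
  \<open>hnorm z * hnorm z \<le> hnorm z * C\<close>, where \<open>hnorm z\<close> may
  vanish.\<close>

lemma le_if_self_mult_le:
  fixes a b :: real
  assumes "a * a \<le> a * b" "0 \<le> a" "0 \<le> b"
  shows "a \<le> b"
  using assms by (cases "a = 0") (simp_all add: mult_le_cancel_left)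

section \<open>Operators on carrier-based Hilbert spaces\<close>

context complex_hilbert_space
begin

section \<open>Inner product, norm and the Riesz representation theorem\<close>

lemma smult_carrier [simp, intro]: "x \<in> carrier V \<Longrightarrow> c \<odot> x \<in> carrier V"
  using smult_closed by simp

lemma ip_add_right:
  assumes "x \<in> carrier V" "y \<in> carrier V" "z \<in> carrier V"
  shows "ip V x (y \<oplus> z) = ip V x y + ip V x z"
  using assms by (metis M.add.m_closed complex_cnj_add ip_add_left ip_cnj)

lemma ip_smult_right:
  assumes "x \<in> carrier V" "y \<in> carrier V"
  shows "ip V x (c \<odot> y) = cnj c * ip V x y"
  using assms by (metis complex_cnj_mult ip_cnj ip_smult_left smult_carrier)

lemma ip_minus_left:
  assumes "x \<in> carrier V" "y \<in> carrier V" "z \<in> carrier V"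
  shows "ip V (x \<ominus> y) z = ip V x z - ip V y z"
proof -
  have "ip V x z = ip V (x \<ominus> y) z + ip V y z"
    using assms by (metis M.minus_closed ip_add_left minus_add_cancel)
  then show ?thesis by simp
qed

lemma ip_minus_right:
  assumes "x \<in> carrier V" "y \<in> carrier V" "z \<in> carrier V"
  shows "ip V x (y \<ominus> z) = ip V x y - ip V x z"
  using assms by (metis M.minus_closed complex_cnj_diff ip_cnj ip_minus_left)

lemma ip_zero_left [simp]: "y \<in> carrier V \<Longrightarrow> ip V \<zero> y = 0"
  using ip_add_left[of \<zero> \<zero> y] by simp

lemma ip_zero_right [simp]: "y \<in> carrier V \<Longrightarrow> ip V y \<zero> = 0"
  using ip_cnj[of \<zero> y] by simp

lemma ip_finsum_left:
  assumes "finite A" "\<And>i. i \<in> A \<Longrightarrow> f i \<in> carrier V" "y \<in> carrier V"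
  shows "ip V (\<Oplus>i\<in>A. f i) y = (\<Sum>i\<in>A. ip V (f i) y)"
  using assms
proof (induction A rule: finite_induct)
  case (insert i A)
  then have "(\<Oplus>j\<in>insert i A. f j) = f i \<oplus> (\<Oplus>j\<in>A. f j)"
    by (intro M.finsum_insert) auto
  with insert show ?case
    by (simp add: ip_add_left M.finsum_closed Pi_def)
qed simp

text \<open>Testing at \<open>x = y \<ominus> z\<close> suffices. This trades equations between
  vectors for scalar ones and makes adjoints unique.\<close>

lemma ip_extensionality:
  assumes "y \<in> carrier V" "z \<in> carrier V" "\<And>x. x \<in> carrier V \<Longrightarrow> ip V x y = ip V x z"
  shows "y = z"
proof -
  have "ip V (y \<ominus> z) (y \<ominus> z) = 0"
    using assms by (simp add: ip_minus_right)
  then have "y \<ominus> z = \<zero>"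
    using ip_definite assms by simp
  then show ?thesis
    using assms minus_add_cancel[of y z] by simp
qed

text \<open>Conjugate symmetry forces \<open>ip V x x\<close> to be real. Stated in the complex
  numbers so that squared norms can be rewritten inside sums of inner products.\<close>

lemma ip_self:
  assumes "x \<in> carrier V"
  shows "ip V x x = of_real ((hnorm V x)\<^sup>2)"
proof -
  have "Im (ip V x x) = 0"
    using ip_cnj[OF assms assms] by (metis Reals_cnj_iff complex_is_Real_iff)
  then show ?thesis
    using ip_nonneg[OF assms] by (simp add: hnorm_def complex_eq_iff)
qed

lemma hnorm_nonneg [simp]: "x \<in> carrier V \<Longrightarrow> 0 \<le> hnorm V x"
  by (simp add: hnorm_def ip_nonneg)

lemma hnorm_zero [simp]: "hnorm V \<zero> = 0"
  by (simp add: hnorm_def)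

lemma hnorm_eq_0: "x \<in> carrier V \<Longrightarrow> hnorm V x = 0 \<Longrightarrow> x = \<zero>"
  using ip_definite ip_self by fastforce

lemma hnorm_smult:
  assumes "x \<in> carrier V"
  shows "hnorm V (c \<odot> x) = cmod c * hnorm V x"
proof -
  have "ip V (c \<odot> x) (c \<odot> x) = (c * cnj c) * ip V x x"
    using assms by (simp add: ip_smult_left ip_smult_right)
  also have "\<dots> = of_real ((cmod c * hnorm V x)\<^sup>2)"
    using assms by (simp add: ip_self power_mult_distrib flip: complex_norm_square)
  finally have "ip V (c \<odot> x) (c \<odot> x) = of_real ((cmod c * hnorm V x)\<^sup>2)" .
  then have "(hnorm V (c \<odot> x))\<^sup>2 = (cmod c * hnorm V x)\<^sup>2"
    using assms by (simp only: ip_self smult_carrier of_real_eq_iff)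
  then show ?thesis
    using assms by (simp add: power2_eq_iff_nonneg)
qed

lemma hnorm_add_sq:
  assumes "x \<in> carrier V" "y \<in> carrier V"
  shows "(hnorm V (x \<oplus> y))\<^sup>2 = (hnorm V x)\<^sup>2 + (hnorm V y)\<^sup>2 + 2 * Re (ip V x y)"
proof -
  have "complex_of_real ((hnorm V (x \<oplus> y))\<^sup>2) = ip V (x \<oplus> y) (x \<oplus> y)"
    using assms by (simp only: ip_self M.add.m_closed)
  also have "\<dots> = ip V x x + ip V y y + (ip V x y + cnj (ip V x y))"
    using assms ip_cnj[of x y] by (simp add: ip_add_left ip_add_right)
  also have "\<dots> = of_real ((hnorm V x)\<^sup>2 + (hnorm V y)\<^sup>2 + 2 * Re (ip V x y))"
    using assms by (simp add: ip_self complex_add_cnj)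
  finally show ?thesis
    unfolding of_real_eq_iff .
qed

lemma hnorm_minus_sq:
  assumes "x \<in> carrier V" "y \<in> carrier V"
  shows "(hnorm V (x \<ominus> y))\<^sup>2 = (hnorm V x)\<^sup>2 + (hnorm V y)\<^sup>2 - 2 * Re (ip V x y)"
proof -
  have "complex_of_real ((hnorm V (x \<ominus> y))\<^sup>2) = ip V (x \<ominus> y) (x \<ominus> y)"
    using assms by (simp only: ip_self M.minus_closed)
  also have "\<dots> = ip V x x + ip V y y - (ip V x y + cnj (ip V x y))"
    using assms ip_cnj[of x y] by (simp add: ip_minus_left ip_minus_right)
  also have "\<dots> = of_real ((hnorm V x)\<^sup>2 + (hnorm V y)\<^sup>2 - 2 * Re (ip V x y))"
    using assms by (simp add: ip_self complex_add_cnj)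
  finally show ?thesis
    unfolding of_real_eq_iff .
qed

lemma Cauchy_Schwarz:
  assumes "x \<in> carrier V" "y \<in> carrier V"
  shows "cmod (ip V x y) \<le> hnorm V x * hnorm V y"
proof (cases "hnorm V y = 0")
  case True
  then have "y = \<zero>" using hnorm_eq_0 assms by blast
  then show ?thesis using assms by simp
next
  case False
  define N where "N = (hnorm V y)\<^sup>2"
  define p where "p = ip V x y"
  have N: "N > 0" using False by (simp add: N_def)
  \<comment> \<open>The subtracted vector is the orthogonal projection of \<open>x\<close> onto the
    line of \<open>y\<close>.\<close>
  have "0 \<le> (hnorm V (x \<ominus> (p / of_real N) \<odot> y))\<^sup>2"
    by simp
  also have "\<dots> = (hnorm V x)\<^sup>2 + (cmod p / N)\<^sup>2 * N - 2 * Re (cnj (p / of_real N) * p)"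
    using assms N
    by (simp add: hnorm_minus_sq hnorm_smult ip_smult_right power_mult_distrib norm_divide
        power_divide flip: N_def p_def)
  also have "cnj (p / of_real N) * p = of_real ((cmod p)\<^sup>2 / N)"
  proof -
    have "cnj (p / of_real N) * p = (p * cnj p) / of_real N" by simp
    then show ?thesis by (simp flip: complex_norm_square)
  qed
  finally have "0 \<le> (hnorm V x)\<^sup>2 + (cmod p / N)\<^sup>2 * N - 2 * ((cmod p)\<^sup>2 / N)"
    by (simp only: Re_complex_of_real)
  moreover have "(cmod p / N)\<^sup>2 * N = (cmod p)\<^sup>2 / N"
    using N by (simp add: power2_eq_square)
  ultimately have "(cmod p)\<^sup>2 / N \<le> (hnorm V x)\<^sup>2"
    by linarith
  then have "(cmod p)\<^sup>2 \<le> (hnorm V x * hnorm V y)\<^sup>2"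
    using N by (simp add: N_def power_mult_distrib divide_simps)
  then show ?thesis
    unfolding p_def using assms by (metis abs_le_square_iff abs_norm_cancel abs_of_nonneg
        hnorm_nonneg mult_nonneg_nonneg)
qed

lemma hnorm_triangle:
  assumes "x \<in> carrier V" "y \<in> carrier V"
  shows "hnorm V (x \<oplus> y) \<le> hnorm V x + hnorm V y"
proof (rule power2_le_imp_le)
  have "Re (ip V x y) \<le> hnorm V x * hnorm V y"
    using Cauchy_Schwarz[OF assms] complex_Re_le_cmod order_trans by blast
  then show "(hnorm V (x \<oplus> y))\<^sup>2 \<le> (hnorm V x + hnorm V y)\<^sup>2"
    using assms by (simp add: hnorm_add_sq power2_sum)
qed (use assms in simp)

text \<open>The representing vector minimises \<open>J x = \<parallel>x\<parallel>\<^sup>2 - 2 Re (\<phi> x)\<close>; minimising sequences are Cauchy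
  by the parallelogram identity \<open>J x + J y - 2 J ((x + y) / 2) = \<parallel>x - y\<parallel>\<^sup>2 / 2\<close>.\<close>

lemma Riesz_representation:
  assumes add: "\<And>x y. \<lbrakk>x \<in> carrier V; y \<in> carrier V\<rbrakk> \<Longrightarrow> \<phi> (x \<oplus> y) = \<phi> x + \<phi> y"
    and smult: "\<And>c x. x \<in> carrier V \<Longrightarrow> \<phi> (c \<odot> x) = c * \<phi> x"
    and bounded: "\<And>x. x \<in> carrier V \<Longrightarrow> cmod (\<phi> x) \<le> B * hnorm V x"
  shows "\<exists>z\<in>carrier V. \<forall>x\<in>carrier V. \<phi> x = ip V x z"
proof -
  define J where "J x = (hnorm V x)\<^sup>2 - 2 * Re (\<phi> x)" for x
  have Re_bound: "Re (\<phi> x) \<le> B * hnorm V x" if "x \<in> carrier V" for x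
    using bounded[OF that] complex_Re_le_cmod order_trans by blast
  \<comment> \<open>Completing the square:
    \<open>J x \<ge> t^2 - 2 * B * t = (t - B)^2 - B^2\<close> for
    \<open>t = hnorm V x\<close>.\<close>
  have J_lower: "- B\<^sup>2 \<le> J x" if "x \<in> carrier V" for x
    using Re_bound[OF that] zero_le_power2[of "hnorm V x - B"]
    by (simp add: J_def power2_diff mult.commute)
  define m where "m = (INF x\<in>carrier V. J x)"
  have bdd: "bdd_below (J ` carrier V)"
    using J_lower by (intro bdd_belowI2) auto
  have m_le: "m \<le> J x" if "x \<in> carrier V" for x
    unfolding m_def using bdd that by (intro cINF_lower)
  have "\<exists>x\<in>carrier V. J x < m + 1 / real (Suc k)" for k
    using cINF_less_iff[OF _ bdd, of "m + 1 / real (Suc k)"] M.zero_closed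
    unfolding m_def[symmetric] by auto
  then obtain s where s: "\<And>k. s k \<in> carrier V" "\<And>k. J (s k) < m + 1 / real (Suc k)"
    by metis
  have parallelogram: "(hnorm V (x \<ominus> y))\<^sup>2 = 2 * J x + 2 * J y - 4 * J ((1/2) \<odot> (x \<oplus> y))"
    if "x \<in> carrier V" "y \<in> carrier V" for x y
    using that
    by (simp add: J_def hnorm_minus_sq hnorm_add_sq hnorm_smult smult add power_mult_distrib
        power_divide field_simps)
  \<comment> \<open>The midpoint has \<open>J\<close> at least \<open>m\<close>, so the
    parallelogram identity leaves only the excesses of \<open>J (s i)\<close> and
    \<open>J (s j)\<close> over \<open>m\<close>.\<close>
  have close: "(hnorm V (s i \<ominus> s j))\<^sup>2 < 2 / real (Suc i) + 2 / real (Suc j)" for i j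
    using parallelogram[OF s(1)[of i] s(1)[of j]] s(2)[of i] s(2)[of j]
      m_le[of "(1/2) \<odot> (s i \<oplus> s j)"] s(1) by simp
  have "\<exists>N. \<forall>i\<ge>N. \<forall>j\<ge>N. hnorm V (s i \<ominus> s j) < e" if "e > 0" for e
  proof -
    obtain N where N: "4 / e\<^sup>2 < real N"
      using reals_Archimedean2 by blast
    have "hnorm V (s i \<ominus> s j) < e" if "i \<ge> N" "j \<ge> N" for i j
    proof -
      have "2 / real (Suc i) \<le> 2 / real (Suc N)" "2 / real (Suc j) \<le> 2 / real (Suc N)"
        using that by (auto intro!: divide_left_mono)
      then have "(hnorm V (s i \<ominus> s j))\<^sup>2 < 4 / real (Suc N)"
        using close[of i j] by simp
      also have "4 / real (Suc N) < e\<^sup>2"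
      proof -
        have "0 < e\<^sup>2" using \<open>e > 0\<close> by simp
        moreover from this have "4 < real N * e\<^sup>2"
          using N by (simp add: divide_less_eq)
        ultimately have "4 < real (Suc N) * e\<^sup>2"
          by (simp only: of_nat_Suc distrib_right)
        then show ?thesis by (simp add: divide_less_eq mult.commute)
      qed
      finally show ?thesis
        using \<open>e > 0\<close> by (meson less_imp_le power2_less_imp_less)
    qed
    then show ?thesis by blast
  qed
  then obtain z where z: "z \<in> carrier V" "(\<lambda>k. hnorm V (s k \<ominus> z)) \<longlonglongrightarrow> 0"
    using complete[of s] s(1) by auto
  \<comment> \<open>The expansion of \<open>J\<close> at \<open>z\<close> serves twice: with
    \<open>h = s k \<ominus> z\<close> it shows that \<open>z\<close> is a minimiser, and with
    \<open>h\<close> a multiple of \<open>x\<close> that the first variation vanishes.\<close>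
  have J_shift: "J (z \<oplus> h) = J z + (hnorm V h)\<^sup>2 + 2 * Re (ip V h z - \<phi> h)"
    if "h \<in> carrier V" for h
    using z that ip_cnj[of h z] by (simp add: J_def hnorm_add_sq add)
  \<comment> \<open>In place of continuity of \<open>J\<close>: the expansion at \<open>z\<close>
    bounds \<open>J (s k)\<close> from below by \<open>J z\<close> minus a multiple of
    \<open>hnorm V (s k \<ominus> z)\<close>, which tends to 0.\<close>
  have "J z \<le> m"
  proof (rule LIMSEQ_le)
    show "(\<lambda>k. J z - 2 * (hnorm V z + B) * hnorm V (s k \<ominus> z)) \<longlonglongrightarrow> J z"
      by (rule tendsto_eq_intros z refl | simp)+
    show "(\<lambda>k. m + 1 / real (Suc k)) \<longlonglongrightarrow> m"
      using LIMSEQ_inverse_real_of_nat_add[of m] by (simp add: inverse_eq_divide)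
    have "J z - 2 * (hnorm V z + B) * hnorm V (s k \<ominus> z) \<le> m + 1 / real (Suc k)" for k
    proof -
      define h where "h = s k \<ominus> z"
      have h: "h \<in> carrier V" using s z by (simp add: h_def)
      have "z \<oplus> h = s k"
        using s z by (metis M.minus_eq M.a_comm M.a_lcomm M.a_inv_closed M.r_neg M.r_zero h_def)
      then have "J (s k) = J z + (hnorm V h)\<^sup>2 + 2 * Re (ip V h z - \<phi> h)"
        using J_shift[OF h] by simp
      moreover have "- Re (ip V h z) \<le> hnorm V h * hnorm V z"
        using Cauchy_Schwarz[OF h z(1)] abs_Re_le_cmod[of "ip V h z"] by linarith
      moreover have "2 * (hnorm V z + B) * hnorm V h = 2 * (hnorm V h * hnorm V z) + 2 * (B * hnorm V h)"
        by (simp add: algebra_simps)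
      moreover note Re_bound[OF h] s(2)[of k] zero_le_power2[of "hnorm V h"]
      moreover have "Re (ip V h z - \<phi> h) = Re (ip V h z) - Re (\<phi> h)" by simp
      ultimately show ?thesis
        unfolding h_def[symmetric] by linarith
    qed
    then show "\<exists>N. \<forall>k\<ge>N. J z - 2 * (hnorm V z + B) * hnorm V (s k \<ominus> z) \<le> m + 1 / real (Suc k)"
      by blast
  qed
  have "\<phi> x = ip V x z" if x: "x \<in> carrier V" for x
  proof (rule ccontr)
    define w where "w = ip V x z - \<phi> x"
    \<comment> \<open>In the direction \<open>- t * cnj w\<close> times \<open>x\<close> the first
      variation is \<open>- 2 * t * (cmod w)^2\<close>. This \<open>t\<close> keeps the quadratic
      term below \<open>t * (cmod w)^2\<close>, so \<open>J\<close> would drop below its minimum;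
      the summand 1 in the denominator also covers \<open>x = \<zero>\<close>.\<close>
    define t where "t = 1 / (1 + (hnorm V x)\<^sup>2)"
    assume "\<phi> x \<noteq> ip V x z"
    then have w: "(cmod w)\<^sup>2 > 0" by (simp add: w_def)
    have D: "1 + (hnorm V x)\<^sup>2 > 0" by (simp add: add_pos_nonneg)
    then have t: "t > 0" "t * (hnorm V x)\<^sup>2 \<le> 1" by (simp_all add: t_def)
    define h where "h = (- (of_real t * cnj w)) \<odot> x"
    have h: "h \<in> carrier V" using x by (simp add: h_def)
    have "J z \<le> J (z \<oplus> h)"
      using \<open>J z \<le> m\<close> m_le[of "z \<oplus> h"] z h by simp
    then have "0 \<le> (hnorm V h)\<^sup>2 + 2 * Re (ip V h z - \<phi> h)"
      using J_shift[OF h] by simp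
    moreover have "ip V h z - \<phi> h = of_real (- (t * (cmod w)\<^sup>2))"
    proof -
      have "ip V h z - \<phi> h = - (of_real t * cnj w) * w"
        using x z by (simp add: h_def ip_smult_left smult w_def algebra_simps)
      also have "\<dots> = - (of_real t * (w * cnj w))" by simp
      finally show ?thesis by (simp flip: complex_norm_square)
    qed
    moreover have "(hnorm V h)\<^sup>2 = (t * (hnorm V x)\<^sup>2) * (t * (cmod w)\<^sup>2)"
      using x by (simp add: h_def hnorm_smult norm_mult power_mult_distrib power2_eq_square)
    moreover have "(t * (hnorm V x)\<^sup>2) * (t * (cmod w)\<^sup>2) \<le> 1 * (t * (cmod w)\<^sup>2)"
      using t w by (intro mult_right_mono) auto
    moreover have "t * (cmod w)\<^sup>2 > 0" using t w by simp
    ultimately show False by simp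
  qed
  with z(1) show ?thesis by blast
qed

section \<open>Algebra of bounded operators\<close>

lemma minus_eq_smult: "x \<in> carrier V \<Longrightarrow> y \<in> carrier V \<Longrightarrow> x \<ominus> y = x \<oplus> (-1) \<odot> y"
  by (rule ip_extensionality) (simp_all add: ip_minus_right ip_add_right ip_smult_right)

lemma bounded_opI:
  assumes "\<And>x. x \<in> carrier V \<Longrightarrow> T x \<in> carrier V"
    and "\<And>x y. x \<in> carrier V \<Longrightarrow> y \<in> carrier V \<Longrightarrow> T (x \<oplus> y) = T x \<oplus> T y"
    and "\<And>c x. x \<in> carrier V \<Longrightarrow> T (c \<odot> x) = c \<odot> T x"
    and "\<And>x. x \<in> carrier V \<Longrightarrow> hnorm V (T x) \<le> B * hnorm V x"
  shows "bounded_op V T"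
  using assms unfolding bounded_op_def by (auto intro: exI[of _ B])

lemma bounded_op_closed: "bounded_op V T \<Longrightarrow> x \<in> carrier V \<Longrightarrow> T x \<in> carrier V"
  unfolding bounded_op_def by blast

lemma bounded_op_linear:
  assumes "bounded_op V T" "x \<in> carrier V"
  shows "y \<in> carrier V \<Longrightarrow> T (x \<oplus> y) = T x \<oplus> T y" "T (c \<odot> x) = c \<odot> T x"
  using assms unfolding bounded_op_def by auto

lemma bounded_opE:
  assumes "bounded_op V T"
  obtains B where "B \<ge> 0" "\<And>x. x \<in> carrier V \<Longrightarrow> hnorm V (T x) \<le> B * hnorm V x"
proof -
  obtain B where B: "\<forall>x\<in>carrier V. hnorm V (T x) \<le> B * hnorm V x"
    using assms unfolding bounded_op_def by auto
  show ?thesis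
  \<comment> \<open>The constant in \<open>bounded_op\<close> has no prescribed sign, whereas
    composing bounds requires nonnegative ones.\<close>
  proof (rule that[of "max B 0"])
    fix x assume x: "x \<in> carrier V"
    have "B * hnorm V x \<le> max B 0 * hnorm V x"
      using x by (intro mult_right_mono) auto
    then show "hnorm V (T x) \<le> max B 0 * hnorm V x"
      using bspec[OF B x] by linarith
  qed simp
qed

text \<open>\<open>bounded_op\<close> sees only values on the carrier. Hence boundedness passes from
  an explicit operator to one known only there, such as \<open>H V T\<close>.\<close>

lemma bounded_op_cong:
  assumes "bounded_op V T" "\<And>x. x \<in> carrier V \<Longrightarrow> S x = T x"
  shows "bounded_op V S"
proof -
  obtain B where "\<And>x. x \<in> carrier V \<Longrightarrow> hnorm V (T x) \<le> B * hnorm V x"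
    using bounded_opE[OF assms(1)] by blast
  then show ?thesis
    by (intro bounded_opI[of S B]) (simp_all add: assms(2) bounded_op_closed[OF assms(1)] bounded_op_linear[OF assms(1)])
qed

lemma bounded_op_id: "bounded_op V id"
  by (rule bounded_opI[of _ 1]) simp_all

lemma bounded_op_zero: "bounded_op V (\<lambda>x. \<zero>)"
  by (rule bounded_opI[of _ 0]) simp_all

lemma bounded_op_comp:
  assumes "bounded_op V S" "bounded_op V T"
  shows "bounded_op V (S \<circ> T)"
proof -
  obtain A where A: "A \<ge> 0" "\<And>x. x \<in> carrier V \<Longrightarrow> hnorm V (S x) \<le> A * hnorm V x"
    using bounded_opE[OF assms(1)] by blast
  obtain B where B: "B \<ge> 0" "\<And>x. x \<in> carrier V \<Longrightarrow> hnorm V (T x) \<le> B * hnorm V x"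
    using bounded_opE[OF assms(2)] by blast
  show ?thesis
  proof (rule bounded_opI[of _ "A * B"])
    fix x assume x: "x \<in> carrier V"
    have "hnorm V (S (T x)) \<le> A * hnorm V (T x)"
      using A(2) x by (simp add: bounded_op_closed[OF assms(1)] bounded_op_closed[OF assms(2)])
    also have "\<dots> \<le> A * (B * hnorm V x)"
      using A(1) B(2)[OF x] by (rule mult_left_mono[rotated])
    finally show "hnorm V ((S \<circ> T) x) \<le> A * B * hnorm V x" by simp
  qed (simp_all add: bounded_op_closed[OF assms(1)] bounded_op_closed[OF assms(2)] bounded_op_linear[OF assms(1)] bounded_op_linear[OF assms(2)])
qed

lemma bounded_op_smult:
  assumes "bounded_op V T"
  shows "bounded_op V (\<lambda>x. c \<odot> T x)"
proof -
  obtain B where B: "B \<ge> 0" "\<And>x. x \<in> carrier V \<Longrightarrow> hnorm V (T x) \<le> B * hnorm V x"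
    using bounded_opE[OF assms] by blast
  show ?thesis
  proof (rule bounded_opI[of _ "cmod c * B"])
    fix x assume x: "x \<in> carrier V"
    show "hnorm V (c \<odot> T x) \<le> cmod c * B * hnorm V x"
      using B(2)[OF x] x
      by (simp add: hnorm_smult bounded_op_closed[OF assms(1)] mult_left_mono mult.assoc)
    fix d
    show "c \<odot> T (d \<odot> x) = d \<odot> (c \<odot> T x)"
      using x smult_assoc1[of c d "T x"] smult_assoc1[of d c "T x"]
      by (simp add: bounded_op_closed[OF assms(1)] bounded_op_linear[OF assms(1)] mult.commute)
  next
    fix x y assume "x \<in> carrier V" "y \<in> carrier V"
    then show "c \<odot> T (x \<oplus> y) = c \<odot> T x \<oplus> c \<odot> T y"
      using smult_r_distr[of c "T x" "T y"] by (simp add: bounded_op_closed[OF assms(1)] bounded_op_linear[OF assms(1)])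
  qed (simp add: bounded_op_closed[OF assms(1)])
qed

lemma bounded_op_add:
  assumes "bounded_op V S" "bounded_op V T"
  shows "bounded_op V (\<lambda>x. S x \<oplus> T x)"
proof -
  obtain A where A: "A \<ge> 0" "\<And>x. x \<in> carrier V \<Longrightarrow> hnorm V (S x) \<le> A * hnorm V x"
    using bounded_opE[OF assms(1)] by blast
  obtain B where B: "B \<ge> 0" "\<And>x. x \<in> carrier V \<Longrightarrow> hnorm V (T x) \<le> B * hnorm V x"
    using bounded_opE[OF assms(2)] by blast
  show ?thesis
  proof (rule bounded_opI[of _ "A + B"])
    fix x assume x: "x \<in> carrier V"
    show "hnorm V (S x \<oplus> T x) \<le> (A + B) * hnorm V x"
      using A(2)[OF x] B(2)[OF x] hnorm_triangle[of "S x" "T x"] x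
      by (simp add: bounded_op_closed[OF assms(1)] bounded_op_closed[OF assms(2)] distrib_right)
    show "S (c \<odot> x) \<oplus> T (c \<odot> x) = c \<odot> (S x \<oplus> T x)" for c
      using x smult_r_distr[of c "S x" "T x"]
      by (simp add: bounded_op_closed[OF assms(1)] bounded_op_closed[OF assms(2)] bounded_op_linear[OF assms(1)] bounded_op_linear[OF assms(2)])
  qed (simp_all add: bounded_op_closed[OF assms(1)] bounded_op_closed[OF assms(2)] bounded_op_linear[OF assms(1)] bounded_op_linear[OF assms(2)] M.a_ac)
qed

lemma bounded_op_minus:
  assumes "bounded_op V S" "bounded_op V T"
  shows "bounded_op V (\<lambda>x. S x \<ominus> T x)"
  using bounded_op_add[OF assms(1) bounded_op_smult[OF assms(2), of "-1"]]
  by (rule bounded_op_cong) (use assms in \<open>simp add: minus_eq_smult bounded_op_closed\<close>)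

lemma bounded_op_finsum:
  assumes "finite A" "\<And>i. i \<in> A \<Longrightarrow> bounded_op V (f i)"
  shows "bounded_op V (\<lambda>x. \<Oplus>i\<in>A. f i x)"
  using assms
proof (induction A rule: finite_induct)
  case (insert i A)
  then have "bounded_op V (\<lambda>x. f i x \<oplus> (\<Oplus>j\<in>A. f j x))"
    by (intro bounded_op_add) auto
  then show ?case
  proof (rule bounded_op_cong)
    fix x assume "x \<in> carrier V"
    then have "f j x \<in> carrier V" if "j \<in> insert i A" for j
      using bounded_op_closed insert.prems that by blast
    then show "(\<Oplus>j\<in>insert i A. f j x) = f i x \<oplus> (\<Oplus>j\<in>A. f j x)"
      using insert.hyps by (intro M.finsum_insert) auto
  qed
qed (simp add: bounded_op_zero)

lemma bounded_op_word: "(\<And>i. bounded_op V (T i)) \<Longrightarrow> bounded_op V (word_op T \<alpha>)"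
  by (induction \<alpha>) (simp_all add: bounded_op_id bounded_op_comp)

lemma hnorm_finsum_le:
  assumes "finite A" "\<And>i. i \<in> A \<Longrightarrow> f i \<in> carrier V"
  shows "hnorm V (\<Oplus>i\<in>A. f i) \<le> (\<Sum>i\<in>A. hnorm V (f i))"
  using assms
proof (induction A rule: finite_induct)
  case (insert i A)
  then have "(\<Oplus>j\<in>insert i A. f j) = f i \<oplus> (\<Oplus>j\<in>A. f j)"
    by (intro M.finsum_insert) auto
  moreover have "hnorm V (f i \<oplus> (\<Oplus>j\<in>A. f j)) \<le> hnorm V (f i) + hnorm V (\<Oplus>j\<in>A. f j)"
    using insert by (intro hnorm_triangle M.finsum_closed) auto
  moreover have "hnorm V (\<Oplus>j\<in>A. f j) \<le> (\<Sum>j\<in>A. hnorm V (f j))"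
    using insert by blast
  ultimately show ?case
    using insert.hyps by simp
qed simp

subsection \<open>The operator norm\<close>

lemma opnorm_le:
  assumes "B \<ge> 0" "\<And>x. x \<in> carrier V \<Longrightarrow> hnorm V (T x) \<le> B * hnorm V x"
  shows "opnorm V T \<le> B"
  unfolding opnorm_def
proof (rule cSUP_least)
  show "{x \<in> carrier V. hnorm V x \<le> 1} \<noteq> {}"
    by (auto intro!: exI[of _ \<zero>])
  fix x assume "x \<in> {x \<in> carrier V. hnorm V x \<le> 1}"
  then show "hnorm V (T x) \<le> B"
    using assms(2)[of x] mult_left_mono[of "hnorm V x" 1 B] assms(1) by simp
qed

text \<open>Boundedness is what makes the supremum in \<open>opnorm\<close> that of a set bounded
  above; otherwise its value would carry no information.\<close>

lemma hnorm_le_opnorm_unit: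
  assumes "bounded_op V T" "x \<in> carrier V" "hnorm V x \<le> 1"
  shows "hnorm V (T x) \<le> opnorm V T"
proof -
  obtain B where B: "B \<ge> 0" "\<And>x. x \<in> carrier V \<Longrightarrow> hnorm V (T x) \<le> B * hnorm V x"
    using bounded_opE[OF assms(1)] by blast
  have "hnorm V (T y) \<le> B" if "y \<in> carrier V" "hnorm V y \<le> 1" for y
    using B(2)[of y] mult_left_mono[of "hnorm V y" 1 B] B(1) that by simp
  then show ?thesis
    unfolding opnorm_def using assms by (intro cSUP_upper bdd_aboveI2[of _ _ B]) auto
qed

lemma opnorm_nonneg:
  assumes "bounded_op V T"
  shows "0 \<le> opnorm V T"
proof -
  have "0 \<le> hnorm V (T \<zero>)"
    using assms by (simp add: bounded_op_closed)
  then show ?thesis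
    using hnorm_le_opnorm_unit[OF assms, of \<zero>] by simp
qed

lemma hnorm_le_opnorm:
  assumes "bounded_op V T" "x \<in> carrier V"
  shows "hnorm V (T x) \<le> opnorm V T * hnorm V x"
proof (cases "hnorm V x = 0")
  case True
  obtain B where "\<And>x. x \<in> carrier V \<Longrightarrow> hnorm V (T x) \<le> B * hnorm V x"
    using bounded_opE[OF assms(1)] by blast
  from this[OF assms(2)] True show ?thesis by simp
next
  case False
  define u where "u = of_real (inverse (hnorm V x)) \<odot> x"
  have pos: "hnorm V x > 0"
    using False hnorm_nonneg[OF assms(2)] by linarith
  have u: "u \<in> carrier V" "hnorm V u = 1"
    using assms pos by (simp_all add: u_def hnorm_smult norm_inverse)
  have "hnorm V (T u) = inverse (hnorm V x) * hnorm V (T x)"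
    using assms pos
    by (simp add: u_def bounded_op_linear[OF assms(1)] bounded_op_closed[OF assms(1)] hnorm_smult norm_inverse)
  then have "hnorm V (T x) = hnorm V (T u) * hnorm V x"
    using pos by simp
  then show ?thesis
    using hnorm_le_opnorm_unit[OF assms(1) u(1)] u(2) pos by (simp add: mult_right_mono)
qed

subsection \<open>Adjoints\<close>

lemma adj_unique:
  assumes "z \<in> carrier V" "\<And>x. x \<in> carrier V \<Longrightarrow> ip V (T x) y = ip V x z"
  shows "adj V T y = z"
  unfolding adj_def
proof (rule the_equality)
  fix w assume "w \<in> carrier V \<and> (\<forall>x\<in>carrier V. ip V (T x) y = ip V x w)"
  then show "w = z"
    using assms by (intro ip_extensionality) auto
qed (use assms in blast)

text \<open>Existence is the Riesz theorem for \<open>x \<mapsto> ip V (T x) y\<close>, a functional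
  bounded by \<open>B * hnorm V y\<close>.\<close>

lemma
  assumes T: "bounded_op V T" and y: "y \<in> carrier V"
  shows adj_closed: "adj V T y \<in> carrier V"
    and ip_adj: "x \<in> carrier V \<Longrightarrow> ip V (T x) y = ip V x (adj V T y)"
proof -
  obtain B where B: "B \<ge> 0" "\<And>x. x \<in> carrier V \<Longrightarrow> hnorm V (T x) \<le> B * hnorm V x"
    using bounded_opE[OF T] by blast
  have "cmod (ip V (T x) y) \<le> (B * hnorm V y) * hnorm V x" if "x \<in> carrier V" for x
  proof -
    have "cmod (ip V (T x) y) \<le> hnorm V (T x) * hnorm V y"
      using Cauchy_Schwarz T y that by (simp add: bounded_op_closed)
    also have "\<dots> \<le> (B * hnorm V x) * hnorm V y"
      using B(2)[OF that] y by (intro mult_right_mono) auto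
    finally show ?thesis by (simp add: mult_ac)
  qed
  then obtain z where z: "z \<in> carrier V" "\<And>x. x \<in> carrier V \<Longrightarrow> ip V (T x) y = ip V x z"
    using Riesz_representation[of "\<lambda>x. ip V (T x) y" "B * hnorm V y"] T y
    by (auto simp: bounded_op_linear[OF T] bounded_op_closed[OF T] ip_add_left ip_smult_left)
  then have "adj V T y = z" by (rule adj_unique)
  with z show "adj V T y \<in> carrier V" "x \<in> carrier V \<Longrightarrow> ip V (T x) y = ip V x (adj V T y)"
    by auto
qed

lemma ip_adj_left:
  assumes "bounded_op V T" "x \<in> carrier V" "y \<in> carrier V"
  shows "ip V (adj V T x) y = ip V x (T y)"
  using ip_adj[OF assms] ip_cnj[OF assms(3) adj_closed[OF assms(1,2)]]
    ip_cnj[OF bounded_op_closed[OF assms(1,3)] assms(2)] by simp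

text \<open>For \<open>z = adj V T y\<close>, \<open>(hnorm V z)^2\<close> equals
  \<open>ip V (T z) y\<close>, hence is at most \<open>B * hnorm V z * hnorm V y\<close>; cancelling
  \<open>hnorm V z\<close> shows that the adjoint inherits the bound of \<open>T\<close>.\<close>

lemma bounded_op_adj:
  assumes T: "bounded_op V T"
  shows "bounded_op V (adj V T)"
proof -
  obtain B where B: "B \<ge> 0" "\<And>x. x \<in> carrier V \<Longrightarrow> hnorm V (T x) \<le> B * hnorm V x"
    using bounded_opE[OF T] by blast
  show ?thesis
  proof (rule bounded_opI[of _ B])
    fix y assume y: "y \<in> carrier V"
    define z where "z = adj V T y"
    have z: "z \<in> carrier V" using adj_closed[OF T y] by (simp add: z_def)
    have "complex_of_real ((hnorm V z)\<^sup>2) = ip V (T z) y"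
      using ip_adj[OF T y z] z by (simp add: ip_self flip: z_def)
    then have "(hnorm V z)\<^sup>2 = cmod (ip V (T z) y)"
      by (metis abs_of_nonneg norm_of_real zero_le_power2)
    also have "\<dots> \<le> hnorm V (T z) * hnorm V y"
      using Cauchy_Schwarz T y z by (simp add: bounded_op_closed)
    also have "\<dots> \<le> (B * hnorm V z) * hnorm V y"
      using B(2)[OF z] y by (intro mult_right_mono) auto
    finally have "hnorm V z * hnorm V z \<le> hnorm V z * (B * hnorm V y)"
      by (simp add: power2_eq_square mult_ac)
    then show "hnorm V (adj V T y) \<le> B * hnorm V y"
      unfolding z_def[symmetric] by (rule le_if_self_mult_le) (use B(1) y z in simp_all)
    show "adj V T (c \<odot> y) = c \<odot> adj V T y" for c
      using y bounded_op_closed[OF T]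
      by (intro adj_unique) (simp_all add: adj_closed[OF T] ip_smult_right ip_adj[OF T])
  next
    fix x y assume "x \<in> carrier V" "y \<in> carrier V"
    then show "adj V T (x \<oplus> y) = adj V T x \<oplus> adj V T y"
      using bounded_op_closed[OF T]
      by (intro adj_unique) (simp_all add: adj_closed[OF T] ip_add_right ip_adj[OF T])
  qed (use T in \<open>simp add: adj_closed\<close>)
qed

lemma adj_id: "y \<in> carrier V \<Longrightarrow> adj V id y = y"
  by (rule adj_unique) simp_all

lemma adj_comp:
  assumes S: "bounded_op V S" and T: "bounded_op V T" and y: "y \<in> carrier V"
  shows "adj V (S \<circ> T) y = adj V T (adj V S y)"
proof (rule adj_unique)
  show "adj V T (adj V S y) \<in> carrier V"
    using adj_closed[OF T adj_closed[OF S y]] .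
  fix x assume x: "x \<in> carrier V"
  show "ip V ((S \<circ> T) x) y = ip V x (adj V T (adj V S y))"
    using ip_adj[OF S y bounded_op_closed[OF T x]] ip_adj[OF T adj_closed[OF S y] x] by simp
qed

lemma bounded_op_hom_part:
  fixes T :: "'n::finite \<Rightarrow> 'x \<Rightarrow> 'x"
  assumes "\<And>i. bounded_op V (T i)"
  shows "bounded_op V (hom_part V c T k)"
  unfolding hom_part_def[abs_def] using assms
  by (intro bounded_op_finsum bounded_op_smult bounded_op_word) auto

lemma bounded_op_adj_hom_part:
  fixes T :: "'n::finite \<Rightarrow> 'x \<Rightarrow> 'x"
  assumes "\<And>i. bounded_op V (T i)"
  shows "bounded_op V (adj_hom_part V c T k)"
  unfolding adj_hom_part_def[abs_def] using assms
  by (intro bounded_op_finsum bounded_op_smult bounded_op_adj bounded_op_word) auto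

lemma ip_hom_part:
  fixes T :: "'n::finite \<Rightarrow> 'x \<Rightarrow> 'x"
  assumes "\<And>i. bounded_op V (T i)" "x \<in> carrier V" "y \<in> carrier V"
  shows "ip V (hom_part V c T k x) y = (\<Sum>\<alpha>\<in>words k. c \<alpha> * ip V (word_op T \<alpha> x) y)"
  using assms unfolding hom_part_def
  by (simp add: ip_finsum_left ip_smult_left bounded_op_closed bounded_op_word)

text \<open>Conjugated coefficients on adjoint words form the adjoint polynomial. In the quadratic
  form the two halves of \<open>H\<close> are therefore conjugate, and only the analytic one has to
  be computed.\<close>

lemma ip_adj_hom_part:
  fixes T :: "'n::finite \<Rightarrow> 'x \<Rightarrow> 'x"
  assumes "\<And>i. bounded_op V (T i)" "x \<in> carrier V" "y \<in> carrier V"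
  shows "ip V (adj_hom_part V (\<lambda>\<alpha>. cnj (c \<alpha>)) T k x) y = cnj (ip V (hom_part V c T k y) x)"
proof -
  have "ip V (adj V (word_op T \<alpha>) x) y = cnj (ip V (word_op T \<alpha> y) x)" for \<alpha>
    using assms by (simp add: ip_adj_left bounded_op_word bounded_op_closed flip: ip_cnj)
  then show ?thesis
    using assms unfolding ip_hom_part[OF assms(1,3,2)] adj_hom_part_def
    by (simp add: ip_finsum_left ip_smult_left bounded_op_word adj_closed)
qed

text \<open>Cauchy-Schwarz bounds the error by
  \<open>opnorm V (D N) * hnorm V x * hnorm V y\<close>. Only this weak form of convergence enters
  when coefficients are extracted.\<close>

lemma op_sums_ip:
  assumes sums: "op_sums V f S" and f: "\<And>k. bounded_op V (f k)"
    and x: "x \<in> carrier V" and y: "y \<in> carrier V"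
  shows "(\<lambda>k. ip V (f k x) y) sums ip V (S x) y"
proof -
  define D where "D N = (\<lambda>v. (\<Oplus>k\<in>{..<N}. f k v) \<ominus> S v)" for N :: nat
  have S: "bounded_op V S" and D0: "(\<lambda>N. opnorm V (D N)) \<longlonglongrightarrow> 0"
    using sums unfolding op_sums_def D_def by auto
  have D: "bounded_op V (D N)" for N
    unfolding D_def using f S by (intro bounded_op_minus bounded_op_finsum) auto
  have ipD: "ip V (D N x) y = (\<Sum>k<N. ip V (f k x) y) - ip V (S x) y" for N
    unfolding D_def using f S x y
    by (simp add: ip_minus_left ip_finsum_left bounded_op_closed M.finsum_closed Pi_def)
  have "(\<lambda>N. ip V (D N x) y) \<longlonglongrightarrow> 0"
  proof (rule Lim_null_comparison)
    show "(\<lambda>N. opnorm V (D N) * hnorm V x * hnorm V y) \<longlonglongrightarrow> 0"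
      using tendsto_mult_left_zero[OF tendsto_mult_left_zero[OF D0]] .
    have "cmod (ip V (D N x) y) \<le> opnorm V (D N) * hnorm V x * hnorm V y" for N
    proof -
      have "cmod (ip V (D N x) y) \<le> hnorm V (D N x) * hnorm V y"
        using Cauchy_Schwarz D x y by (simp add: bounded_op_closed)
      also have "\<dots> \<le> opnorm V (D N) * hnorm V x * hnorm V y"
        using hnorm_le_opnorm[OF D x] y by (intro mult_right_mono) auto
      finally show ?thesis .
    qed
    then show "\<forall>\<^sub>F N in sequentially. norm (ip V (D N x) y) \<le> opnorm V (D N) * hnorm V x * hnorm V y"
      by simp
  qed
  then show ?thesis
    unfolding sums_def ipD LIM_zero_iff .
qed

subsection \<open>Homogeneous polynomials on row balls\<close>

text \<open>Moving each \<open>T i\<close> across the inner product turns the sum into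
  \<open>ip V (row_square V T v) v\<close>, which the norm of the row controls.\<close>

lemma sum_adj_sq_le:
  fixes T :: "'n::finite \<Rightarrow> 'x \<Rightarrow> 'x"
  assumes T: "T \<in> row_cball V r" and v: "v \<in> carrier V"
  shows "(\<Sum>i\<in>UNIV. (hnorm V (adj V (T i) v))\<^sup>2) \<le> (r * hnorm V v)\<^sup>2"
proof -
  have Ti: "bounded_op V (T i)" for i
    using T by (simp add: row_cball_def)
  have R: "bounded_op V (row_square V T)"
    unfolding row_square_def[abs_def]
    using bounded_op_comp[OF Ti bounded_op_adj[OF Ti]]
    by (intro bounded_op_finsum) (simp_all add: comp_def)
  have r: "sqrt (opnorm V (row_square V T)) \<le> r"
    using T by (simp add: row_cball_def)
  then have "opnorm V (row_square V T) \<le> r\<^sup>2"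
    using sqrt_le_D by blast
  have "complex_of_real (\<Sum>i\<in>UNIV. (hnorm V (adj V (T i) v))\<^sup>2)
      = (\<Sum>i\<in>UNIV. ip V (adj V (T i) v) (adj V (T i) v))"
    using Ti v by (simp add: ip_self adj_closed)
  also have "\<dots> = ip V (row_square V T v) v"
    using Ti v unfolding row_square_def
    by (simp add: ip_finsum_left ip_adj[OF Ti] adj_closed bounded_op_closed)
  finally have "(\<Sum>i\<in>UNIV. (hnorm V (adj V (T i) v))\<^sup>2) = Re (ip V (row_square V T v) v)"
    by (metis Re_complex_of_real)
  also have "\<dots> \<le> hnorm V (row_square V T v) * hnorm V v"
    using Cauchy_Schwarz R v complex_Re_le_cmod order_trans by (metis bounded_op_closed)
  also have "\<dots> \<le> (opnorm V (row_square V T) * hnorm V v) * hnorm V v"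
    using hnorm_le_opnorm[OF R v] v by (intro mult_right_mono) auto
  also have "\<dots> \<le> (r\<^sup>2 * hnorm V v) * hnorm V v"
    using \<open>opnorm V (row_square V T) \<le> r\<^sup>2\<close> v by (intro mult_right_mono) auto
  finally show ?thesis
    by (simp add: power_mult_distrib power2_eq_square mult_ac)
qed

lemma sum_adj_word_sq_le:
  fixes T :: "'n::finite \<Rightarrow> 'x \<Rightarrow> 'x"
  assumes T: "T \<in> row_cball V r" and v: "v \<in> carrier V"
  shows "(\<Sum>\<alpha>\<in>words k. (hnorm V (adj V (word_op T \<alpha>) v))\<^sup>2) \<le> (r ^ k * hnorm V v)\<^sup>2"
  using v
proof (induction k arbitrary: v)
  case 0
  then show ?case using adj_id[OF 0] by (simp add: id_def)
next
  case (Suc k)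
  have Ti: "bounded_op V (T i)" for i
    using T by (simp add: row_cball_def)
  \<comment> \<open>Adjoints reverse products: the first letter acts first, so the inner sum is the
    induction hypothesis at the vector \<open>adj V (T i) v\<close>.\<close>
  have "(\<Sum>\<alpha>\<in>words (Suc k). (hnorm V (adj V (word_op T \<alpha>) v))\<^sup>2)
      = (\<Sum>i\<in>UNIV. \<Sum>\<beta>\<in>words k. (hnorm V (adj V (word_op T \<beta>) (adj V (T i) v)))\<^sup>2)"
    using Suc.prems Ti by (simp add: sum_words_Suc adj_comp bounded_op_word)
  also have "\<dots> \<le> (\<Sum>i\<in>UNIV. (r ^ k * hnorm V (adj V (T i) v))\<^sup>2)"
    using Suc Ti by (intro sum_mono) (simp add: adj_closed)
  also have "\<dots> = (r ^ k)\<^sup>2 * (\<Sum>i\<in>UNIV. (hnorm V (adj V (T i) v))\<^sup>2)"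
    by (simp add: power_mult_distrib sum_distrib_left)
  also have "\<dots> \<le> (r ^ k)\<^sup>2 * (r * hnorm V v)\<^sup>2"
    using sum_adj_sq_le[OF T Suc.prems] by (intro mult_left_mono) auto
  also have "\<dots> = (r ^ Suc k * hnorm V v)\<^sup>2"
    by (simp add: power_mult_distrib mult_ac)
  finally show ?case .
qed

lemma sum_cmod_adj_word_le:
  fixes T :: "'n::finite \<Rightarrow> 'x \<Rightarrow> 'x"
  assumes T: "T \<in> row_cball V r" and r: "r \<ge> 0" and v: "v \<in> carrier V"
  shows "(\<Sum>\<alpha>\<in>words k. cmod (c \<alpha>) * hnorm V (adj V (word_op T \<alpha>) v))
      \<le> sqrt (\<Sum>\<alpha>\<in>words k. (cmod (c \<alpha>))\<^sup>2) * r ^ k * hnorm V v"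
proof -
  have Ti: "bounded_op V (T i)" for i
    using T by (simp add: row_cball_def)
  have "(\<Sum>\<alpha>\<in>words k. cmod (c \<alpha>) * hnorm V (adj V (word_op T \<alpha>) v))
      = (\<Sum>\<alpha>\<in>words k. \<bar>cmod (c \<alpha>)\<bar> * \<bar>hnorm V (adj V (word_op T \<alpha>) v)\<bar>)"
    using Ti v by (simp add: adj_closed bounded_op_word)
  also have "\<dots> \<le> L2_set (\<lambda>\<alpha>. cmod (c \<alpha>)) (words k)
      * L2_set (\<lambda>\<alpha>. hnorm V (adj V (word_op T \<alpha>) v)) (words k)"
    by (rule L2_set_mult_ineq)
  also have "\<dots> \<le> sqrt (\<Sum>\<alpha>\<in>words k. (cmod (c \<alpha>))\<^sup>2) * (r ^ k * hnorm V v)"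
    unfolding L2_set_def using sum_adj_word_sq_le[OF T v] r v
    by (intro mult_left_mono real_le_lsqrt) (simp_all add: sum_nonneg)
  finally show ?thesis by (simp add: mult.assoc)
qed

lemma opnorm_adj_hom_part_le:
  fixes T :: "'n::finite \<Rightarrow> 'x \<Rightarrow> 'x"
  assumes T: "T \<in> row_cball V r" and r: "r \<ge> 0"
  shows "opnorm V (adj_hom_part V c T k) \<le> sqrt (\<Sum>\<alpha>\<in>words k. (cmod (c \<alpha>))\<^sup>2) * r ^ k"
proof (rule opnorm_le)
  have Ti: "bounded_op V (T i)" for i
    using T by (simp add: row_cball_def)
  fix v assume v: "v \<in> carrier V"
  have "hnorm V (adj_hom_part V c T k v)
      \<le> (\<Sum>\<alpha>\<in>words k. hnorm V (c \<alpha> \<odot> adj V (word_op T \<alpha>) v))"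
    unfolding adj_hom_part_def using Ti v
    by (intro hnorm_finsum_le) (simp_all add: adj_closed bounded_op_word)
  also have "\<dots> = (\<Sum>\<alpha>\<in>words k. cmod (c \<alpha>) * hnorm V (adj V (word_op T \<alpha>) v))"
    using Ti v by (simp add: hnorm_smult adj_closed bounded_op_word)
  also note sum_cmod_adj_word_le[OF T r v]
  finally show "hnorm V (adj_hom_part V c T k v)
      \<le> sqrt (\<Sum>\<alpha>\<in>words k. (cmod (c \<alpha>))\<^sup>2) * r ^ k * hnorm V v" .
qed (use r in \<open>simp add: sum_nonneg\<close>)

text \<open>A row contraction controls adjoint words on a vector, not the words themselves, so the
  triangle inequality used for \<open>adj_hom_part\<close> would lose a factor here. Instead the
  image \<open>w\<close> is paired with itself, the words pass to \<open>w\<close> as adjoints, and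
  one factor \<open>hnorm V w\<close> cancels.\<close>

lemma opnorm_hom_part_le:
  fixes T :: "'n::finite \<Rightarrow> 'x \<Rightarrow> 'x"
  assumes T: "T \<in> row_cball V r" and r: "r \<ge> 0"
  shows "opnorm V (hom_part V c T k) \<le> sqrt (\<Sum>\<alpha>\<in>words k. (cmod (c \<alpha>))\<^sup>2) * r ^ k"
proof (rule opnorm_le)
  have Ti: "bounded_op V (T i)" for i
    using T by (simp add: row_cball_def)
  let ?C = "sqrt (\<Sum>\<alpha>\<in>words k. (cmod (c \<alpha>))\<^sup>2) * r ^ k"
  show C: "0 \<le> ?C" using r by (simp add: sum_nonneg)
  fix v assume v: "v \<in> carrier V"
  define w where "w = hom_part V c T k v"
  have w: "w \<in> carrier V"
    unfolding w_def using bounded_op_closed[OF bounded_op_hom_part[OF Ti] v] .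
  have "complex_of_real ((hnorm V w)\<^sup>2) = (\<Sum>\<alpha>\<in>words k. c \<alpha> * ip V v (adj V (word_op T \<alpha>) w))"
    using ip_hom_part[where T = T and c = c and k = k, OF Ti v w] Ti v w
    by (simp add: ip_self ip_adj[OF bounded_op_word[OF Ti]] bounded_op_word flip: w_def)
  then have "(hnorm V w)\<^sup>2 = cmod (\<Sum>\<alpha>\<in>words k. c \<alpha> * ip V v (adj V (word_op T \<alpha>) w))"
    by (metis abs_of_nonneg norm_of_real zero_le_power2)
  also have "\<dots> \<le> (\<Sum>\<alpha>\<in>words k. cmod (c \<alpha>) * (hnorm V v * hnorm V (adj V (word_op T \<alpha>) w)))"
    using Ti v w
    by (intro order_trans[OF norm_sum] sum_mono)
      (simp add: norm_mult Cauchy_Schwarz adj_closed bounded_op_word mult_left_mono)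
  also have "\<dots> = (\<Sum>\<alpha>\<in>words k. cmod (c \<alpha>) * hnorm V (adj V (word_op T \<alpha>) w)) * hnorm V v"
    by (simp add: sum_distrib_left mult_ac)
  also have "\<dots> \<le> (?C * hnorm V w) * hnorm V v"
    using sum_cmod_adj_word_le[OF T r w] v by (intro mult_right_mono) auto
  finally have "hnorm V w * hnorm V w \<le> hnorm V w * (?C * hnorm V v)"
    by (simp add: power2_eq_square mult_ac)
  then show "hnorm V (hom_part V c T k v) \<le> ?C * hnorm V v"
    unfolding w_def[symmetric] by (rule le_if_self_mult_le) (use C v w in simp_all)
qed

end

section \<open>The truncated Fock space\<close>

text \<open>A copy of the Euclidean space with index set \<open>W\<close>, transported along
  \<open>e\<close> into functions on \<open>'u\<close>. Vanishing off the image makes a vector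
  determined by its coordinates, as definiteness of the inner product demands.\<close>

definition coord_space :: "'i set \<Rightarrow> ('i \<Rightarrow> 'u) \<Rightarrow> ('u \<Rightarrow> complex) hilbert" where
  "coord_space W e = \<lparr>
     carrier = {f. \<forall>u. u \<notin> e ` W \<longrightarrow> f u = 0}, monoid.mult = (\<lambda>f g u. 0), one = (\<lambda>u. 0),
     ring.zero = (\<lambda>u. 0), add = (\<lambda>f g u. f u + g u), smult = (\<lambda>c f u. c * f u),
     ip = (\<lambda>f g. \<Sum>\<alpha>\<in>W. f (e \<alpha>) * cnj (g (e \<alpha>)))\<rparr>"

definition embed :: "'i set \<Rightarrow> ('i \<Rightarrow> 'u) \<Rightarrow> ('i \<Rightarrow> complex) \<Rightarrow> 'u \<Rightarrow> complex" where
  "embed W e h u = (if u \<in> e ` W then h (inv_into W e u) else 0)"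

lemma embed_apply [simp]: "inj_on e W \<Longrightarrow> \<alpha> \<in> W \<Longrightarrow> embed W e h (e \<alpha>) = h \<alpha>"
  by (simp add: embed_def)

lemma coord_space_sel [simp]:
  "\<zero>\<^bsub>coord_space W e\<^esub> = (\<lambda>u. 0)"
  "f \<oplus>\<^bsub>coord_space W e\<^esub> g = (\<lambda>u. f u + g u)"
  "c \<odot>\<^bsub>coord_space W e\<^esub> f = (\<lambda>u. c * f u)"
  "ip (coord_space W e) f g = (\<Sum>\<alpha>\<in>W. f (e \<alpha>) * cnj (g (e \<alpha>)))"
  by (simp_all add: coord_space_def)

lemma carrier_coord_space: "f \<in> carrier (coord_space W e) \<longleftrightarrow> (\<forall>u. u \<notin> e ` W \<longrightarrow> f u = 0)"
  by (simp add: coord_space_def)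

lemma embed_closed [simp]: "embed W e h \<in> carrier (coord_space W e)"
  by (simp add: carrier_coord_space embed_def)

lemma coord_space_eqI:
  assumes "f \<in> carrier (coord_space W e)" "g \<in> carrier (coord_space W e)"
    and "\<And>\<alpha>. \<alpha> \<in> W \<Longrightarrow> f (e \<alpha>) = g (e \<alpha>)"
  shows "f = g"
  using assms unfolding carrier_coord_space by (metis ext imageE)

lemma hnorm_coord_space: "hnorm (coord_space W e) f = sqrt (\<Sum>\<alpha>\<in>W. (cmod (f (e \<alpha>)))\<^sup>2)"
  unfolding hnorm_def
  by (simp add: complex_mult_cnj flip: cmod_power2)

lemma cmod_le_hnorm_coord_space:
  assumes "finite W" "\<alpha> \<in> W"
  shows "cmod (f (e \<alpha>)) \<le> hnorm (coord_space W e) f"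
  unfolding hnorm_coord_space
  using assms member_le_sum[of \<alpha> W "\<lambda>\<alpha>. (cmod (f (e \<alpha>)))\<^sup>2"] by (intro real_le_rsqrt) simp

lemma module_coord_space: "module complex_ring (coord_space W e)"
proof (rule moduleI)
  show "cring complex_ring" by (rule cring_from_type_algebra)
  show "abelian_group (coord_space W e)"
  proof (rule abelian_groupI)
    fix f assume f: "f \<in> carrier (coord_space W e)"
    show "\<exists>g\<in>carrier (coord_space W e). g \<oplus>\<^bsub>coord_space W e\<^esub> f = \<zero>\<^bsub>coord_space W e\<^esub>"
      using f by (intro bexI[of _ "\<lambda>u. - f u"]) (auto simp: carrier_coord_space)
  qed (auto simp: carrier_coord_space algebra_simps)
qed (auto simp: carrier_coord_space algebra_simps)

text \<open>Subtraction in HOL-Algebra rests on an inverse given by a definite description, so it is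
  identified by adding \<open>g\<close> back.\<close>

lemma coord_space_minus:
  assumes "f \<in> carrier (coord_space W e)" "g \<in> carrier (coord_space W e)"
  shows "(f \<ominus>\<^bsub>coord_space W e\<^esub> g) u = f u - g u"
proof -
  interpret module complex_ring "coord_space W e" by (rule module_coord_space)
  have "(f \<ominus>\<^bsub>coord_space W e\<^esub> g) \<oplus>\<^bsub>coord_space W e\<^esub> g = f"
    using M.minus_add_cancel assms by blast
  then show ?thesis by (metis add_diff_cancel_right' coord_space_sel(2))
qed

lemma complex_hilbert_space_coord_space:
  fixes e :: "'i \<Rightarrow> 'u"
  assumes W: "finite W" and inj: "inj_on e W"
  shows "complex_hilbert_space (coord_space W e)"
proof -
  interpret module complex_ring "coord_space W e" by (rule module_coord_space)
  show ?thesis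
  proof unfold_locales
    fix f assume f: "f \<in> carrier (coord_space W e)"
    show "0 \<le> Re (ip (coord_space W e) f f)"
      by (simp add: complex_mult_cnj sum_nonneg)
    assume "ip (coord_space W e) f f = 0"
    then have "hnorm (coord_space W e) f = 0"
      by (simp add: hnorm_def)
    then have "f (e \<alpha>) = 0" if "\<alpha> \<in> W" for \<alpha>
      using cmod_le_hnorm_coord_space[OF W that, of f e] by simp
    then show "f = \<zero>\<^bsub>coord_space W e\<^esub>"
      using f by (intro coord_space_eqI[OF f M.zero_closed]) simp
  next
    fix s :: "nat \<Rightarrow> 'u \<Rightarrow> complex"
    assume s: "\<And>m. s m \<in> carrier (coord_space W e)"
      and Cau: "\<And>\<epsilon>. \<epsilon> > 0 \<Longrightarrow> \<exists>N. \<forall>m\<ge>N. \<forall>k\<ge>N. hnorm (coord_space W e) (s m \<ominus>\<^bsub>coord_space W e\<^esub> s k) < \<epsilon>"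
    have "convergent (\<lambda>m. s m (e \<alpha>))" if \<alpha>: "\<alpha> \<in> W" for \<alpha>
    proof -
      have "cmod (s m (e \<alpha>) - s k (e \<alpha>)) \<le> hnorm (coord_space W e) (s m \<ominus>\<^bsub>coord_space W e\<^esub> s k)"
        for m k
        using cmod_le_hnorm_coord_space[OF W \<alpha>, of "s m \<ominus>\<^bsub>coord_space W e\<^esub> s k" e]
        by (simp add: coord_space_minus s)
      then have "Cauchy (\<lambda>m. s m (e \<alpha>))"
        unfolding Cauchy_def dist_norm using Cau by (meson order_le_less_trans)
      then show ?thesis by (rule Cauchy_convergent)
    qed
    then obtain l where l: "\<And>\<alpha>. \<alpha> \<in> W \<Longrightarrow> (\<lambda>m. s m (e \<alpha>)) \<longlonglongrightarrow> l \<alpha>"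
      unfolding convergent_def by metis
    \<comment> \<open>The limit is left as a vanishing sum so that it matches the finite sum
      termwise and the limit rules apply.\<close>
    have "(\<lambda>m. hnorm (coord_space W e) (s m \<ominus>\<^bsub>coord_space W e\<^esub> embed W e l)) \<longlonglongrightarrow>
        sqrt (\<Sum>\<alpha>\<in>W. (cmod (l \<alpha> - l \<alpha>))\<^sup>2)"
      unfolding hnorm_coord_space coord_space_minus[OF s embed_closed]
      using l by (intro tendsto_intros) (simp_all add: inj)
    then show "\<exists>x\<in>carrier (coord_space W e).
        (\<lambda>m. hnorm (coord_space W e) (s m \<ominus>\<^bsub>coord_space W e\<^esub> x)) \<longlonglongrightarrow> 0"
      by (intro bexI[of _ "embed W e l"]) simp_all
  qed (auto simp: algebra_simps sum.distrib sum_distrib_left)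
qed

lemma finsum_coord_space:
  assumes "finite A" "\<And>i. i \<in> A \<Longrightarrow> f i \<in> carrier (coord_space W e)"
  shows "(\<Oplus>\<^bsub>coord_space W e\<^esub>i\<in>A. f i) u = (\<Sum>i\<in>A. f i u)"
proof -
  interpret module complex_ring "coord_space W e" by (rule module_coord_space)
  show ?thesis
    using assms
  proof (induction A rule: finite_induct)
    case (insert i A)
    then have "(\<Oplus>\<^bsub>coord_space W e\<^esub>j\<in>insert i A. f j) =
        f i \<oplus>\<^bsub>coord_space W e\<^esub> (\<Oplus>\<^bsub>coord_space W e\<^esub>j\<in>A. f j)"
      by (intro M.finsum_insert) auto
    with insert show ?case by simp
  qed simp
qed

text \<open>Reduces everything to single coordinates. Comparing the Euclidean norm with the sum of
  moduli costs the factor \<open>card W\<close>, harmless because only the existence of a bound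
  matters.\<close>

lemma bounded_op_coord_space:
  assumes W: "finite W" and inj: "inj_on e W" and C: "C \<ge> 0"
    and closed: "\<And>f. f \<in> carrier (coord_space W e) \<Longrightarrow> T f \<in> carrier (coord_space W e)"
    and add: "\<And>f g \<alpha>. \<alpha> \<in> W \<Longrightarrow> T (\<lambda>u. f u + g u) (e \<alpha>) = T f (e \<alpha>) + T g (e \<alpha>)"
    and smult: "\<And>c f \<alpha>. \<alpha> \<in> W \<Longrightarrow> T (\<lambda>u. c * f u) (e \<alpha>) = c * T f (e \<alpha>)"
    and bound: "\<And>f \<alpha>. \<alpha> \<in> W \<Longrightarrow> cmod (T f (e \<alpha>)) \<le> C * hnorm (coord_space W e) f"
  shows "bounded_op (coord_space W e) T"
proof -
  interpret complex_hilbert_space "coord_space W e"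
    using W inj by (rule complex_hilbert_space_coord_space)
  show ?thesis
  proof (rule bounded_opI)
    fix f g c assume f: "f \<in> carrier (coord_space W e)"
    show "T (c \<odot>\<^bsub>coord_space W e\<^esub> f) = c \<odot>\<^bsub>coord_space W e\<^esub> T f"
      using f by (intro coord_space_eqI[OF closed smult_carrier] closed smult_carrier) (simp_all add: smult)
    have "hnorm (coord_space W e) (T f) \<le> (\<Sum>\<alpha>\<in>W. cmod (T f (e \<alpha>)))"
      unfolding hnorm_coord_space using L2_set_le_sum[of W "\<lambda>\<alpha>. cmod (T f (e \<alpha>))"]
      by (simp add: L2_set_def)
    also have "\<dots> \<le> (\<Sum>\<alpha>\<in>W. C * hnorm (coord_space W e) f)"
      using bound by (intro sum_mono)
    finally show "hnorm (coord_space W e) (T f) \<le> (real (card W) * C) * hnorm (coord_space W e) f"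
      by (simp add: mult.assoc)
    assume g: "g \<in> carrier (coord_space W e)"
    show "T (f \<oplus>\<^bsub>coord_space W e\<^esub> g) = T f \<oplus>\<^bsub>coord_space W e\<^esub> T g"
      using f g by (intro coord_space_eqI[OF closed M.add.m_closed] closed M.add.m_closed) (simp_all add: add)
  qed (rule closed)
qed

section \<open>Creation operators on the truncated Fock space and their adjoints\<close>

definition short_words :: "nat \<Rightarrow> 'n list set" where
  "short_words k = {\<alpha>. length \<alpha> \<le> k}"

lemma finite_short_words [simp]: "finite (short_words k :: 'n::finite list set)"
  unfolding short_words_def using finite_lists_length_le[of "UNIV :: 'n set" k] by simp

text \<open>The left creation operators scaled by \<open>r\<close>, compressed to words of length at most \<open>k\<close>.\<close>

definition creation ::
  "nat \<Rightarrow> ('n list \<Rightarrow> 'u) \<Rightarrow> real \<Rightarrow> 'n \<Rightarrow> ('u \<Rightarrow> complex) \<Rightarrow> 'u \<Rightarrow> complex" where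
  "creation k e r i f = embed (short_words k) e
     (\<lambda>\<alpha>. case \<alpha> of [] \<Rightarrow> 0 | j # \<beta> \<Rightarrow> if j = i then of_real r * f (e \<beta>) else 0)"

text \<open>The adjoint of \<open>creation\<close>. At length \<open>k\<close> the prolonged word
  \<open>i # \<alpha>\<close> leaves the truncation, hence the value 0.\<close>

definition annihilation ::
  "nat \<Rightarrow> ('n list \<Rightarrow> 'u) \<Rightarrow> real \<Rightarrow> 'n \<Rightarrow> ('u \<Rightarrow> complex) \<Rightarrow> 'u \<Rightarrow> complex" where
  "annihilation k e r i f = embed (short_words k) e
     (\<lambda>\<alpha>. if length \<alpha> < k then of_real r * f (e (i # \<alpha>)) else 0)"

context
  fixes k :: nat and e :: "'n::finite list \<Rightarrow> 'u" and r :: real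
  assumes inj: "inj_on e (short_words k)" and r: "0 < r" "r < 1"
begin

abbreviation (input) "Fock \<equiv> coord_space (short_words k) e"

interpretation complex_hilbert_space Fock
  using finite_short_words inj by (rule complex_hilbert_space_coord_space)

lemma creation_apply:
  "\<alpha> \<in> short_words k \<Longrightarrow> creation k e r i f (e \<alpha>) =
     (case \<alpha> of [] \<Rightarrow> 0 | j # \<beta> \<Rightarrow> if j = i then of_real r * f (e \<beta>) else 0)"
  by (simp add: creation_def inj)

lemma annihilation_apply:
  "\<alpha> \<in> short_words k \<Longrightarrow> annihilation k e r i f (e \<alpha>) =
     (if length \<alpha> < k then of_real r * f (e (i # \<alpha>)) else 0)"
  by (simp add: annihilation_def inj)

lemma bounded_op_creation: "bounded_op Fock (creation k e r i)"
proof (rule bounded_op_coord_space[OF finite_short_words inj])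
  fix f \<alpha> assume \<alpha>: "\<alpha> \<in> (short_words k :: 'n list set)"
  have "cmod (f (e \<beta>)) \<le> hnorm Fock f" if "\<alpha> = j # \<beta>" for j \<beta>
    using \<alpha> that by (intro cmod_le_hnorm_coord_space[OF finite_short_words]) (simp add: short_words_def)
  moreover have "0 \<le> hnorm Fock f" by (simp add: hnorm_coord_space sum_nonneg)
  ultimately show "cmod (creation k e r i f (e \<alpha>)) \<le> r * hnorm Fock f"
    using \<alpha> r by (auto simp: creation_apply norm_mult split: list.split)
qed (use r in \<open>simp_all add: creation_apply ring_distribs split: list.split\<close>,
    simp_all add: creation_def)

lemma adj_creation:
  assumes g: "g \<in> carrier Fock"
  shows "adj Fock (creation k e r i) g = annihilation k e r i g"
proof (rule adj_unique)
  fix f assume "f \<in> carrier Fock"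
  \<comment> \<open>These are the words that can still be prolonged; prefixing \<open>i\<close> maps
    them bijectively onto the short words beginning with \<open>i\<close>, the only ones where the
    left side has nonzero terms.\<close>
  let ?S = "{\<beta> \<in> short_words k. length \<beta> < k} :: 'n list set"
  have "ip Fock (creation k e r i f) g
      = (\<Sum>\<alpha>\<in>(#) i ` ?S. creation k e r i f (e \<alpha>) * cnj (g (e \<alpha>)))"
    unfolding coord_space_sel
  proof (rule sum.mono_neutral_right)
    show "(#) i ` ?S \<subseteq> short_words k" by (auto simp: short_words_def)
    show "\<forall>\<alpha>\<in>short_words k - (#) i ` ?S. creation k e r i f (e \<alpha>) * cnj (g (e \<alpha>)) = 0"
    proof
      fix \<alpha> :: "'n list" assume \<alpha>: "\<alpha> \<in> short_words k - (#) i ` ?S"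
      then show "creation k e r i f (e \<alpha>) * cnj (g (e \<alpha>)) = 0"
        by (cases \<alpha>) (auto simp: creation_apply short_words_def)
    qed
  qed simp
  also have "\<dots> = (\<Sum>\<beta>\<in>?S. of_real r * f (e \<beta>) * cnj (g (e (i # \<beta>))))"
    by (subst sum.reindex) (auto simp: inj_on_def creation_apply short_words_def intro!: sum.cong)
  also have "\<dots> = (\<Sum>\<beta>\<in>?S. f (e \<beta>) * cnj (annihilation k e r i g (e \<beta>)))"
    by (intro sum.cong) (auto simp: annihilation_apply)
  also have "\<dots> = ip Fock f (annihilation k e r i g)"
    unfolding coord_space_sel by (rule sum.mono_neutral_left) (auto simp: annihilation_apply)
  finally show "ip Fock (creation k e r i f) g = ip Fock f (annihilation k e r i g)" .
qed (simp add: annihilation_def)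

text \<open>The row square is diagonal: \<open>r^2\<close> times the projection that kills the
  vacuum coordinate. Its norm is thus at most \<open>r^2 < 1\<close>.\<close>

lemma creation_row_ball: "creation k e r \<in> row_ball Fock"
proof -
  have row: "row_square Fock (creation k e r) g (e \<alpha>) = (if \<alpha> = [] then 0 else of_real (r\<^sup>2) * g (e \<alpha>))"
    if g: "g \<in> carrier Fock" and \<alpha>: "\<alpha> \<in> short_words k" for g \<alpha>
  proof -
    have "row_square Fock (creation k e r) g (e \<alpha>)
        = (\<Sum>i\<in>UNIV. creation k e r i (annihilation k e r i g) (e \<alpha>))"
      unfolding row_square_def adj_creation[OF g]
      by (intro finsum_coord_space) (simp_all add: creation_def)
    also have "\<dots> = (if \<alpha> = [] then 0 else of_real (r\<^sup>2) * g (e \<alpha>))"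
    proof (cases \<alpha>)
      case (Cons j \<beta>)
      then have "\<beta> \<in> short_words k" "length \<beta> < k" using \<alpha> by (simp_all add: short_words_def)
      then have "creation k e r i (annihilation k e r i g) (e \<alpha>)
          = (if j = i then of_real (r\<^sup>2) * g (e \<alpha>) else 0)" for i
        using \<alpha> Cons by (simp add: creation_apply annihilation_apply power2_eq_square)
      then show ?thesis using Cons by simp
    qed (use \<alpha> in \<open>simp add: creation_apply\<close>)
    finally show ?thesis .
  qed
  have "opnorm Fock (row_square Fock (creation k e r)) \<le> r\<^sup>2"
  proof (rule opnorm_le)
    fix g assume g: "g \<in> carrier Fock"
    have "hnorm Fock (row_square Fock (creation k e r) g)
        \<le> sqrt (\<Sum>\<alpha>\<in>short_words k. (r\<^sup>2 * cmod (g (e \<alpha>)))\<^sup>2)"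
      unfolding hnorm_coord_space
      by (intro real_sqrt_le_mono sum_mono power_mono) (auto simp: row[OF g] norm_mult norm_power)
    also have "\<dots> = r\<^sup>2 * hnorm Fock g"
      by (simp only: hnorm_coord_space power_mult_distrib real_sqrt_mult real_sqrt_abs abs_power2
          flip: sum_distrib_left)
    finally show "hnorm Fock (row_square Fock (creation k e r) g) \<le> r\<^sup>2 * hnorm Fock g" .
  qed simp
  also have "r\<^sup>2 < 1" using r by (simp add: power_less_one_iff)
  finally show ?thesis
    by (simp add: row_ball_def bounded_op_creation)
qed

text \<open>Creation prefixes \<open>\<alpha>\<close> to basis words, so the coordinate at \<gamma>
  is fed only by the word left after removing the prefix \<open>\<alpha>\<close>.\<close>

lemma word_op_creation:
  assumes "f \<in> carrier Fock" "\<gamma> \<in> short_words k"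
  shows "word_op (creation k e r) \<alpha> f (e \<gamma>) =
    (if take (length \<alpha>) \<gamma> = \<alpha> then of_real (r ^ length \<alpha>) * f (e (drop (length \<alpha>) \<gamma>)) else 0)"
  using assms(2)
proof (induction \<alpha> arbitrary: \<gamma>)
  case (Cons i \<alpha>)
  show ?case
  proof (cases \<gamma>)
    case (Cons j \<delta>)
    then have "\<delta> \<in> short_words k" using Cons.prems by (simp add: short_words_def)
    then show ?thesis using Cons Cons.prems Cons.IH[of \<delta>] by (simp add: creation_apply)
  qed (use Cons.prems in \<open>simp add: creation_apply\<close>)
qed simp

text \<open>A nonempty word sends the vacuum to its own basis vector and pushes the part of degree
  \<open>k\<close> out of the truncation. Pairing with \<open>h\<close> therefore sees exactly the
  words of length \<open>k\<close>. For \<open>k = 0\<close> the vacuum and the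
  degree-\<open>k\<close> part would collide.\<close>

lemma creation_hom_part_sums:
  fixes a y :: "'n list \<Rightarrow> complex"
  assumes k: "k \<ge> 1"
  defines "h \<equiv> embed (short_words k) e (\<lambda>\<alpha>. if \<alpha> = [] then 1 else if length \<alpha> = k then y \<alpha> else 0)"
  shows "(\<lambda>j. ip Fock (hom_part Fock a (creation k e r) (Suc j) h) h) sums
           (of_real (r ^ k) * (\<Sum>\<alpha>\<in>words k. a \<alpha> * cnj (y \<alpha>)))"
    and "(hnorm Fock h)\<^sup>2 = 1 + (\<Sum>\<alpha>\<in>words k. (cmod (y \<alpha>))\<^sup>2)"
proof -
  have h: "h \<in> carrier Fock" by (simp add: h_def)
  have he: "h (e \<alpha>) = (if \<alpha> = [] then 1 else if length \<alpha> = k then y \<alpha> else 0)"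
    if "\<alpha> \<in> short_words k" for \<alpha>
    using that inj by (simp add: h_def)
  have word: "ip Fock (word_op (creation k e r) \<alpha> h) h
      = (if length \<alpha> = k then of_real (r ^ k) * cnj (y \<alpha>) else 0)" if \<alpha>: "\<alpha> \<noteq> []" for \<alpha>
  proof -
    have "word_op (creation k e r) \<alpha> h (e \<gamma>) * cnj (h (e \<gamma>))
        = (if \<gamma> = \<alpha> then (if length \<alpha> = k then of_real (r ^ k) * cnj (y \<alpha>) else 0) else 0)"
      if \<gamma>: "\<gamma> \<in> short_words k" for \<gamma>
    proof (cases "take (length \<alpha>) \<gamma> = \<alpha>")
      case True
      define \<delta> where "\<delta> = drop (length \<alpha>) \<gamma>"
      have eq: "\<gamma> = \<alpha> @ \<delta>" using True by (metis \<delta>_def append_take_drop_id)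
      \<comment> \<open>Since \<alpha> is nonempty, \<delta> is too short to have length
        \<open>k\<close>; the only coordinate of \<open>h\<close> it can meet is the vacuum.\<close>
      have "\<delta> \<in> short_words k" "length \<delta> < k"
        using \<gamma> \<alpha> unfolding eq by (auto simp: short_words_def) (cases \<alpha>, auto)
      then have "h (e \<delta>) = (if \<delta> = [] then 1 else 0)" by (simp add: he)
      then show ?thesis
        using word_op_creation[OF h \<gamma>, of \<alpha>] he[OF \<gamma>] eq \<alpha> by (simp flip: \<delta>_def)
    next
      case False
      then have "\<gamma> \<noteq> \<alpha>" by auto
      with False show ?thesis using word_op_creation[OF h \<gamma>, of \<alpha>] by simp
    qed
    then have "ip Fock (word_op (creation k e r) \<alpha> h) h = (\<Sum>\<gamma>\<in>short_words k.
        if \<gamma> = \<alpha> then (if length \<alpha> = k then of_real (r ^ k) * cnj (y \<alpha>) else 0) else 0)"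
      by simp
    also have "\<dots> = (if length \<alpha> = k then of_real (r ^ k) * cnj (y \<alpha>) else 0)"
      by (subst sum.delta[OF finite_short_words]) (simp add: short_words_def)
    finally show ?thesis .
  qed
  have "ip Fock (hom_part Fock a (creation k e r) (Suc j) h) h
      = (if j = k - 1 then of_real (r ^ k) * (\<Sum>\<alpha>\<in>words k. a \<alpha> * cnj (y \<alpha>)) else 0)" for j
  proof -
    have "ip Fock (hom_part Fock a (creation k e r) (Suc j) h) h
        = (\<Sum>\<alpha>\<in>words (Suc j). a \<alpha> * ip Fock (word_op (creation k e r) \<alpha> h) h)"
      using bounded_op_creation h h by (rule ip_hom_part)
    also have "\<dots> = (\<Sum>\<alpha>\<in>words (Suc j). a \<alpha> * (if Suc j = k then of_real (r ^ k) * cnj (y \<alpha>) else 0))"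
    proof (rule sum.cong)
      fix \<alpha> :: "'n list" assume "\<alpha> \<in> words (Suc j)"
      then have len: "length \<alpha> = Suc j" and "\<alpha> \<noteq> []" by (auto simp: words_def)
      show "a \<alpha> * ip Fock (word_op (creation k e r) \<alpha> h) h
          = a \<alpha> * (if Suc j = k then of_real (r ^ k) * cnj (y \<alpha>) else 0)"
        by (simp only: word[OF \<open>\<alpha> \<noteq> []\<close>] len)
    qed simp
    also have "\<dots> = (if j = k - 1 then of_real (r ^ k) * (\<Sum>\<alpha>\<in>words k. a \<alpha> * cnj (y \<alpha>)) else 0)"
    proof (cases "Suc j = k")
      case True
      then show ?thesis by (auto simp: sum_distrib_left mult_ac)
    next
      case False
      then have "j \<noteq> k - 1" using k by auto
      with False show ?thesis by simp
    qed
    finally show ?thesis .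
  qed
  then show "(\<lambda>j. ip Fock (hom_part Fock a (creation k e r) (Suc j) h) h) sums
      (of_real (r ^ k) * (\<Sum>\<alpha>\<in>words k. a \<alpha> * cnj (y \<alpha>)))"
    using sums_single[of "k - 1" "\<lambda>_. of_real (r ^ k) * (\<Sum>\<alpha>\<in>words k. a \<alpha> * cnj (y \<alpha>))"]
    by (simp only:)
  have "(hnorm Fock h)\<^sup>2 = (\<Sum>\<alpha>\<in>short_words k. (cmod (h (e \<alpha>)))\<^sup>2)"
    by (simp add: hnorm_coord_space sum_nonneg)
  also have "\<dots> = (\<Sum>\<alpha>\<in>insert [] (words k). (cmod (h (e \<alpha>)))\<^sup>2)"
    by (rule sum.mono_neutral_right[OF finite_short_words]) (auto simp: he short_words_def words_def)
  also have "\<dots> = 1 + (\<Sum>\<alpha>\<in>words k. (cmod (h (e \<alpha>)))\<^sup>2)"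
    using k he[of "[]"] by (subst sum.insert[OF finite_words]) (auto simp: words_def short_words_def)
  also have "(\<Sum>\<alpha>\<in>words k. (cmod (h (e \<alpha>)))\<^sup>2) = (\<Sum>\<alpha>\<in>words k. (cmod (y \<alpha>))\<^sup>2)"
    using k by (intro sum.cong) (auto simp: he words_def short_words_def)
  finally show "(hnorm Fock h)\<^sup>2 = 1 + (\<Sum>\<alpha>\<in>words k. (cmod (y \<alpha>))\<^sup>2)" .
qed

end

section \<open>Coefficient bounds and the Bohr inequalities\<close>

text \<open>The two halves contribute \<open>s\<close> and its conjugate, so their sum is real;
  Cauchy-Schwarz and the norm bound on \<open>H V T\<close> do the rest.\<close>

lemma (in complex_hilbert_space) harmonic_quadratic_form:
  fixes H :: "('x, 'n::finite) op_function"
  assumes expansion: "has_harmonic_expansion H a"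
    and harmonic: "selfadjoint_harmonic H"
    and contractive: "opnorm V (H V T) \<le> 1"
    and T: "T \<in> row_ball V" and v: "v \<in> carrier V"
    and s: "(\<lambda>j. ip V (hom_part V a T (Suc j) v) v) sums s"
  shows "cmod (a [] * (hnorm V v)\<^sup>2 + 2 * Re s) \<le> (hnorm V v)\<^sup>2"
    and "Im (a []) * (hnorm V v)\<^sup>2 = 0"
proof -
  have Ti: "bounded_op V (T i)" for i
    using T by (simp add: row_ball_def)
  obtain A B where B: "op_sums V (\<lambda>k. adj_hom_part V (\<lambda>\<alpha>. cnj (a \<alpha>)) T (Suc k)) B"
    and A: "op_sums V (\<lambda>k. hom_part V a T (Suc k)) A"
    and H: "\<And>v. v \<in> carrier V \<Longrightarrow> H V T v = B v \<oplus> a [] \<odot> v \<oplus> A v"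
    using expansion T complex_hilbert_space_axioms unfolding has_harmonic_expansion_def by blast
  have bdA: "bounded_op V A" and bdB: "bounded_op V B"
    using A B by (simp_all add: op_sums_def)
  have ipA: "ip V (A v) v = s"
    using op_sums_ip[OF A bounded_op_hom_part[OF Ti] v v] s by (rule sums_unique2)
  have "(\<lambda>j. ip V (adj_hom_part V (\<lambda>\<alpha>. cnj (a \<alpha>)) T (Suc j) v) v) sums cnj s"
    unfolding ip_adj_hom_part[OF Ti v v] using s by (simp only: sums_cnj)
  then have ipB: "ip V (B v) v = cnj s"
    using op_sums_ip[OF B bounded_op_adj_hom_part[OF Ti] v v] sums_unique2 by blast
  \<comment> \<open>The hypothesis on \<open>opnorm\<close> says something about vectors only once
    \<open>H V T\<close> is known to be bounded; the expansion supplies that.\<close>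
  have bdH: "bounded_op V (H V T)"
    using bounded_op_add[OF bounded_op_add[OF bdB bounded_op_smult[OF bounded_op_id, of "a []"]] bdA]
    by (rule bounded_op_cong) (simp add: H)
  have "ip V (H V T v) v = cnj s + a [] * ip V v v + s"
    unfolding H[OF v] using v bounded_op_closed[OF bdA v] bounded_op_closed[OF bdB v]
    by (simp add: ip_add_left ip_smult_left ipA ipB)
  then have ipH: "ip V (H V T v) v = a [] * (hnorm V v)\<^sup>2 + 2 * Re s"
    using v complex_add_cnj[of s] by (simp add: ip_self add.commute add.left_commute)
  have "cmod (ip V (H V T v) v) \<le> hnorm V (H V T v) * hnorm V v"
    using Cauchy_Schwarz bounded_op_closed[OF bdH v] v by blast
  also have "\<dots> \<le> (opnorm V (H V T) * hnorm V v) * hnorm V v"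
    using hnorm_le_opnorm[OF bdH v] v by (intro mult_right_mono) auto
  also have "\<dots> \<le> (1 * hnorm V v) * hnorm V v"
    using contractive v by (intro mult_right_mono) auto
  finally show "cmod (a [] * (hnorm V v)\<^sup>2 + 2 * Re s) \<le> (hnorm V v)\<^sup>2"
    by (simp add: ipH power2_eq_square)
  \<comment> \<open>The expansion alone admits any complex \<open>a []\<close>; it is the
    representation of \<open>H\<close> as a real part that makes the quadratic form, and with it
    \<open>a []\<close>, real.\<close>
  obtain F where F: "free_holomorphic F" and HF: "H V T v = re_op V (F V T) v"
    using harmonic T v complex_hilbert_space_axioms unfolding selfadjoint_harmonic_def by blast
  have bdF: "bounded_op V (F V T)"
    using F T complex_hilbert_space_axioms unfolding free_holomorphic_def op_sums_def by blast
  define z where "z = ip V (F V T v) v"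
  have "ip V (adj V (F V T) v) v = cnj z"
    unfolding z_def ip_adj_left[OF bdF v v] using ip_cnj v bounded_op_closed[OF bdF v] by blast
  then have "ip V (H V T v) v = (1/2) * (z + cnj z)"
    unfolding HF re_op_def z_def using v bounded_op_closed[OF bdF v] adj_closed[OF bdF v]
    by (simp add: ip_smult_left ip_add_left)
  then have "Im (ip V (H V T v) v) = 0"
    by (simp only: complex_add_cnj) simp
  then show "Im (a []) * (hnorm V v)\<^sup>2 = 0"
    unfolding ipH by simp
qed

text \<open>The quadratic form of \<open>H\<close> at the scaled creation operators is evaluated at the vacuum plus or
  minus the normalised vector with coordinates \<open>a \<alpha>\<close>, \<open>\<alpha> \<in> words k\<close>: there it equals
  \<open>2 (a [] \<plusminus> r ^ k * S)\<close>, with \<open>S\<close> the left-hand side.\<close>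

lemma harmonic_coeff_bound:
  fixes a :: "'n::finite list \<Rightarrow> complex"
    and H :: "('u::infinite \<Rightarrow> complex, 'n) op_function"
  assumes expansion: "has_harmonic_expansion H a"
    and harmonic: "selfadjoint_harmonic H"
    and contractive: "\<And>V T. complex_hilbert_space V \<Longrightarrow> T \<in> row_ball V \<Longrightarrow> opnorm V (H V T) \<le> 1"
    and k: "k \<ge> 1"
  shows "sqrt (\<Sum>\<alpha>\<in>words k. (cmod (a \<alpha>))\<^sup>2) \<le> 1 - cmod (a [])"
proof -
  define S where "S = sqrt (\<Sum>\<alpha>\<in>words k. (cmod (a \<alpha>))\<^sup>2)"
  \<comment> \<open>Only here does the infinitude of \<open>'u\<close> enter: it provides as many
    coordinates as there are words of length at most \<open>k\<close>.\<close>
  obtain U :: "'u set" where "finite U" "card U = card (short_words k :: 'n list set)"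
    using infinite_arbitrarily_large[OF infinite_UNIV] by metis
  then obtain e :: "'n list \<Rightarrow> 'u" where inj: "inj_on e (short_words k)"
    using finite_same_card_bij[OF finite_short_words] bij_betw_imp_inj_on by metis
  have form: "cmod (a [] * of_real (1 + Y) + of_real (2 * (x * Re P))) \<le> 1 + Y \<and> Im (a []) = 0"
    if x: "0 < x" "x < 1" and Y: "Y = (\<Sum>\<alpha>\<in>words k. (cmod (y \<alpha>))\<^sup>2)"
      and P: "P = (\<Sum>\<alpha>\<in>words k. a \<alpha> * cnj (y \<alpha>))" for x Y P y
  proof -
    \<comment> \<open>Parametrised by \<open>x = r^k\<close>, so that the final limit is taken in
      the factor in front of \<open>S\<close>.\<close>
    define r where "r = root k x"
    have r: "0 < r" "r < 1" "r ^ k = x"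
      using x k by (simp_all add: r_def)
    let ?V = "coord_space (short_words k) e" and ?T = "creation k e r"
    let ?h = "embed (short_words k) e (\<lambda>\<alpha>. if \<alpha> = [] then 1 else if length \<alpha> = k then y \<alpha> else 0)"
    interpret complex_hilbert_space ?V
      using finite_short_words inj by (rule complex_hilbert_space_coord_space)
    have T: "?T \<in> row_ball ?V"
      using inj r(1,2) by (rule creation_row_ball)
    have norm: "(hnorm ?V ?h)\<^sup>2 = 1 + Y"
      using creation_hom_part_sums(2)[OF inj r(1,2) k] Y by simp
    have pos: "1 + Y > 0" unfolding Y by (intro add_pos_nonneg sum_nonneg) auto
    note * = harmonic_quadratic_form[OF expansion harmonic contractive[OF complex_hilbert_space_axioms T]
        T embed_closed creation_hom_part_sums(1)[where a = a and y = y, OF inj r(1,2) k], unfolded norm, folded P, unfolded r(3)]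
    show ?thesis
      using * pos by simp
  qed
  \<comment> \<open>With \<open>y = 0\<close> only the constant term survives;
    \<open>x = 1/2\<close> is just some point of the open interval.\<close>
  have half: "\<bar>Re (a [])\<bar> \<le> 1" and real: "Im (a []) = 0"
    using form[of "1/2" 0 "\<lambda>_. 0" 0] abs_Re_le_cmod[of "a []"] by simp_all
  have cmod_a: "cmod (a []) = \<bar>Re (a [])\<bar>"
    using real by (simp add: cmod_eq_Re)
  have "x * S \<le> 1 - cmod (a [])" if x: "0 < x" "x < 1" for x
  proof (cases "S = 0")
    case False
    then have S: "S > 0" by (simp add: S_def sum_nonneg less_le)
    have S2: "(\<Sum>\<alpha>\<in>words k. (cmod (a \<alpha>))\<^sup>2) = S\<^sup>2"
      by (simp add: S_def sum_nonneg)
    \<comment> \<open>The condition on \<open>t\<close> admits both signs in one computation. The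
      vector \<open>?y\<close> has norm 1 and pairs with the coefficients to
      \<open>t * S\<close>.\<close>
    have *: "\<bar>Re (a []) + x * (t * S)\<bar> \<le> 1" if t: "t\<^sup>2 = 1" for t :: real
    proof -
      let ?y = "\<lambda>\<alpha>. of_real (t / S) * a \<alpha>"
      have "(\<Sum>\<alpha>\<in>words k. (cmod (?y \<alpha>))\<^sup>2) = (t / S)\<^sup>2 * S\<^sup>2"
        by (simp only: S2[symmetric] sum_distrib_left norm_mult norm_of_real power_mult_distrib power2_abs)
      then have Y: "1 = (\<Sum>\<alpha>\<in>words k. (cmod (?y \<alpha>))\<^sup>2)"
        using S t by (simp add: power_divide)
      have "(\<Sum>\<alpha>\<in>words k. a \<alpha> * cnj (?y \<alpha>)) = (\<Sum>\<alpha>\<in>words k. of_real (t / S) * of_real ((cmod (a \<alpha>))\<^sup>2))"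
        by (intro sum.cong) (simp_all only: complex_norm_square complex_cnj_mult complex_cnj_complex_of_real mult_ac)
      also have "\<dots> = of_real ((t / S) * S\<^sup>2)"
        unfolding S2[symmetric] by (simp only: of_real_mult of_real_sum sum_distrib_left)
      also have "(t / S) * S\<^sup>2 = t * S"
        using S by (simp add: power2_eq_square)
      finally have P: "of_real (t * S) = (\<Sum>\<alpha>\<in>words k. a \<alpha> * cnj (?y \<alpha>))" ..
      have "cmod (a [] * of_real (1 + 1) + of_real (2 * (x * (t * S)))) \<le> 1 + 1"
        using form[OF x Y P] by simp
      moreover have "\<bar>Re (a [] * of_real (1 + 1) + of_real (2 * (x * (t * S))))\<bar>
          \<le> cmod (a [] * of_real (1 + 1) + of_real (2 * (x * (t * S))))"
        by (rule abs_Re_le_cmod)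
      ultimately show ?thesis by simp
    qed
    \<comment> \<open>One of the two signs agrees with that of \<open>Re (a [])\<close>, and for it
      the absolute values add up.\<close>
    from *[of 1] *[of "-1"] show ?thesis
      unfolding cmod_a by (simp add: abs_le_iff abs_if split: if_splits)
  qed (use half in \<open>simp add: cmod_a\<close>)
  then show ?thesis
    unfolding S_def[symmetric] by (rule field_le_mult_one_interval)
qed

section \<open>Geometric series and scalar words\<close>

text \<open>Source of the radii: \<open>q / (1 - q)\<close> is 1 at \<open>q = 1/2\<close> and 1/2
  at \<open>q = 1/3\<close>. With \<open>d = 1 - cmod (a [])\<close>, one tail at 1/2, or two tails
  at 1/3, exactly fill the room left by the constant term.\<close>

lemma geometric_dominated:
  fixes f :: "nat \<Rightarrow> real"
  assumes nonneg: "\<And>k. 0 \<le> f k" and le: "\<And>k. f k \<le> d * q ^ Suc k" and q: "0 \<le> q" "q < 1"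
  shows "summable f" and "suminf f \<le> d * q / (1 - q)"
proof -
  have "(\<lambda>k. (d * q) * q ^ k) sums ((d * q) * (1 / (1 - q)))"
    using q by (intro sums_mult geometric_sums) simp
  then have s: "(\<lambda>k. d * q ^ Suc k) sums (d * q / (1 - q))"
    by (simp add: mult_ac)
  show "summable f"
    using le nonneg by (intro summable_comparison_test'[OF sums_summable[OF s], of 0]) simp
  then show "suminf f \<le> d * q / (1 - q)"
    using suminf_le[OF le _ sums_summable[OF s]] sums_unique[OF s] by simp
qed

lemma suminf_Suc_le:
  fixes f :: "nat \<Rightarrow> real"
  assumes "summable (\<lambda>k. f (Suc k))" "f 0 + (\<Sum>k. f (Suc k)) \<le> c"
  shows "summable f \<and> suminf f \<le> c"
  using assms suminf_split_head[of f] by (simp add: summable_Suc_iff)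

text \<open>The sum factors letter by letter. Scalars are treated directly, not as operators on a
  one-dimensional space, because an arbitrary type \<open>'h\<close> need not contain a nonzero
  Hilbert space.\<close>

lemma sum_word_scalar_sq: "(\<Sum>\<alpha>\<in>words k. (word_scalar r \<alpha>)\<^sup>2) = (norm r ^ k)\<^sup>2"
proof (induction k)
  case (Suc k)
  have "(\<Sum>\<alpha>\<in>words (Suc k). (word_scalar r \<alpha>)\<^sup>2)
      = (\<Sum>i\<in>UNIV. (r $ i)\<^sup>2) * (\<Sum>\<beta>\<in>words k. (word_scalar r \<beta>)\<^sup>2)"
    by (simp add: sum_words_Suc word_scalar_def power_mult_distrib sum_product)
  also have "(\<Sum>i\<in>UNIV. (r $ i)\<^sup>2) = (norm r)\<^sup>2"
    by (simp add: norm_vec_def L2_set_def sum_nonneg)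
  finally show ?case
    by (simp add: Suc power_mult_distrib)
qed (simp add: word_scalar_def)

lemma sum_cmod_word_scalar_le:
  fixes r :: "real ^ 'n"
  assumes "\<And>i. 0 \<le> r $ i"
  shows "0 \<le> (\<Sum>\<alpha>\<in>words k. cmod (c \<alpha>) * word_scalar r \<alpha>)"
    and "(\<Sum>\<alpha>\<in>words k. cmod (c \<alpha>) * word_scalar r \<alpha>)
      \<le> sqrt (\<Sum>\<alpha>\<in>words k. (cmod (c \<alpha>))\<^sup>2) * norm r ^ k"
proof -
  have nonneg: "0 \<le> word_scalar r \<alpha>" for \<alpha>
    unfolding word_scalar_def using assms by (induction \<alpha>) auto
  then show "0 \<le> (\<Sum>\<alpha>\<in>words k. cmod (c \<alpha>) * word_scalar r \<alpha>)"
    by (intro sum_nonneg) auto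
  show "(\<Sum>\<alpha>\<in>words k. cmod (c \<alpha>) * word_scalar r \<alpha>)
      \<le> sqrt (\<Sum>\<alpha>\<in>words k. (cmod (c \<alpha>))\<^sup>2) * norm r ^ k"
    using L2_set_mult_ineq[of "\<lambda>\<alpha>. cmod (c \<alpha>)" "word_scalar r" "words k"] nonneg
    by (simp add: L2_set_def sum_word_scalar_sq)
qed

theorem theorem1p10:
  fixes a :: "'n::finite list \<Rightarrow> complex"
    and H :: "('u::infinite \<Rightarrow> complex, 'n) op_function"
  assumes expansion: "has_harmonic_expansion H a"
    and harmonic: "selfadjoint_harmonic H"
    and contractive: "\<And>V T. complex_hilbert_space V \<Longrightarrow> T \<in> row_ball V \<Longrightarrow> opnorm V (H V T) \<le> 1"
  shows
    "(\<forall>k\<ge>1. sqrt (\<Sum>\<alpha>\<in>words k. (cmod (a \<alpha>))\<^sup>2) \<le> 1 - cmod (a [])) \<and>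
     (\<forall>E :: 'h hilbert. complex_hilbert_space E \<longrightarrow> (\<forall>T\<in>row_cball E (1/2).
        summable (\<lambda>k. opnorm E (hom_part E (\<lambda>\<alpha>. complex_of_real (cmod (a \<alpha>))) T k)) \<and>
        (\<Sum>k. opnorm E (hom_part E (\<lambda>\<alpha>. complex_of_real (cmod (a \<alpha>))) T k)) \<le> 1)) \<and>
     (\<forall>E :: 'h hilbert. complex_hilbert_space E \<longrightarrow> (\<forall>T\<in>row_cball E (1/3).
        summable (\<lambda>k. opnorm E (adj_hom_part E (\<lambda>\<alpha>. complex_of_real (cmod (cnj (a \<alpha>)))) T (Suc k))) \<and>
        summable (\<lambda>k. opnorm E (hom_part E (\<lambda>\<alpha>. complex_of_real (cmod (a \<alpha>))) T (Suc k))) \<and>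
        (\<Sum>k. opnorm E (adj_hom_part E (\<lambda>\<alpha>. complex_of_real (cmod (cnj (a \<alpha>)))) T (Suc k)))
          + cmod (a [])
          + (\<Sum>k. opnorm E (hom_part E (\<lambda>\<alpha>. complex_of_real (cmod (a \<alpha>))) T (Suc k))) \<le> 1)) \<and>
     (\<forall>r :: real ^ 'n. (\<forall>i. 0 \<le> r $ i) \<longrightarrow> norm r \<le> 1/2 \<longrightarrow>
        summable (\<lambda>k. \<Sum>\<alpha>\<in>words k. cmod (a \<alpha>) * word_scalar r \<alpha>) \<and>
        (\<Sum>k. \<Sum>\<alpha>\<in>words k. cmod (a \<alpha>) * word_scalar r \<alpha>) \<le> 1) \<and>
     (\<forall>r :: real ^ 'n. (\<forall>i. 0 \<le> r $ i) \<longrightarrow> norm r \<le> 1/3 \<longrightarrow>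
        summable (\<lambda>k. \<Sum>\<alpha>\<in>words (Suc k). cmod (a \<alpha>) * word_scalar r \<alpha>) \<and>
        cmod (a []) + 2 * (\<Sum>k. \<Sum>\<alpha>\<in>words (Suc k). cmod (a \<alpha>) * word_scalar r \<alpha>) \<le> 1)"
proof (intro conjI)
  define d where "d = 1 - cmod (a [])"
  have coeff: "sqrt (\<Sum>\<alpha>\<in>words k. (cmod (a \<alpha>))\<^sup>2) \<le> d" if "k \<ge> 1" for k
    unfolding d_def using expansion harmonic contractive that by (rule harmonic_coeff_bound)
  then show "\<forall>k\<ge>1. sqrt (\<Sum>\<alpha>\<in>words k. (cmod (a \<alpha>))\<^sup>2) \<le> 1 - cmod (a [])"
    by (simp add: d_def)
  have scaled: "sqrt (\<Sum>\<alpha>\<in>words (Suc k). (cmod (a \<alpha>))\<^sup>2) * q ^ Suc k \<le> d * q ^ Suc k"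
    if "q \<ge> 0" for q :: real and k
    using coeff[of "Suc k"] that by (intro mult_right_mono) simp_all
  \<comment> \<open>Needed to enlarge \<open>norm r\<close> to 1/2 or 1/3 in bounds multiplied by
    \<open>d\<close>.\<close>
  have d: "d \<ge> 0"
  proof (rule order_trans[OF _ coeff[of 1]])
    show "0 \<le> sqrt (\<Sum>\<alpha>\<in>words 1. (cmod (a \<alpha>))\<^sup>2)"
      by (intro real_sqrt_ge_zero sum_nonneg) simp
  qed simp
  show "\<forall>E :: 'h hilbert. complex_hilbert_space E \<longrightarrow> (\<forall>T\<in>row_cball E (1/2).
        summable (\<lambda>k. opnorm E (hom_part E (\<lambda>\<alpha>. complex_of_real (cmod (a \<alpha>))) T k)) \<and>
        (\<Sum>k. opnorm E (hom_part E (\<lambda>\<alpha>. complex_of_real (cmod (a \<alpha>))) T k)) \<le> 1)"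
  proof (intro allI impI ballI)
    fix E :: "'h hilbert" and T :: "'n \<Rightarrow> 'h \<Rightarrow> 'h"
    assume "complex_hilbert_space E" and T: "T \<in> row_cball E (1/2)"
    interpret complex_hilbert_space E by fact
    have Ti: "bounded_op E (T i)" for i
      using T by (simp add: row_cball_def)
    let ?f = "\<lambda>k. opnorm E (hom_part E (\<lambda>\<alpha>. complex_of_real (cmod (a \<alpha>))) T k)"
    have le: "?f k \<le> sqrt (\<Sum>\<alpha>\<in>words k. (cmod (a \<alpha>))\<^sup>2) * (1/2) ^ k" for k
      using opnorm_hom_part_le[OF T, of "\<lambda>\<alpha>. complex_of_real (cmod (a \<alpha>))" k] by simp
    have "?f (Suc k) \<le> d * (1/2) ^ Suc k" for k
      by (rule order_trans[OF le scaled]) simp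
    note * = geometric_dominated[where f = "\<lambda>k. ?f (Suc k)", OF opnorm_nonneg[OF bounded_op_hom_part[OF Ti]] this]
    show "summable ?f \<and> suminf ?f \<le> 1"
      \<comment> \<open>In degree 0 the general polynomial estimate reads
        \<open>cmod (a [])\<close>, complementing the tail bound \<open>d\<close> to 1.\<close>
      using * le[of 0] by (intro suminf_Suc_le) (simp_all add: d_def)
  qed
  show "\<forall>E :: 'h hilbert. complex_hilbert_space E \<longrightarrow> (\<forall>T\<in>row_cball E (1/3).
        summable (\<lambda>k. opnorm E (adj_hom_part E (\<lambda>\<alpha>. complex_of_real (cmod (cnj (a \<alpha>)))) T (Suc k))) \<and>
        summable (\<lambda>k. opnorm E (hom_part E (\<lambda>\<alpha>. complex_of_real (cmod (a \<alpha>))) T (Suc k))) \<and>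
        (\<Sum>k. opnorm E (adj_hom_part E (\<lambda>\<alpha>. complex_of_real (cmod (cnj (a \<alpha>)))) T (Suc k)))
          + cmod (a [])
          + (\<Sum>k. opnorm E (hom_part E (\<lambda>\<alpha>. complex_of_real (cmod (a \<alpha>))) T (Suc k))) \<le> 1)"
  proof (intro allI impI ballI)
    fix E :: "'h hilbert" and T :: "'n \<Rightarrow> 'h \<Rightarrow> 'h"
    assume "complex_hilbert_space E" and T: "T \<in> row_cball E (1/3)"
    interpret complex_hilbert_space E by fact
    have Ti: "bounded_op E (T i)" for i
      using T by (simp add: row_cball_def)
    let ?f = "\<lambda>k. opnorm E (hom_part E (\<lambda>\<alpha>. complex_of_real (cmod (a \<alpha>))) T (Suc k))"
    let ?g = "\<lambda>k. opnorm E (adj_hom_part E (\<lambda>\<alpha>. complex_of_real (cmod (cnj (a \<alpha>)))) T (Suc k))"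
    have f: "?f k \<le> d * (1/3) ^ Suc k" for k
      using opnorm_hom_part_le[OF T, of "\<lambda>\<alpha>. complex_of_real (cmod (a \<alpha>))" "Suc k"]
      by (intro order_trans[OF _ scaled]) simp_all
    have g: "?g k \<le> d * (1/3) ^ Suc k" for k
      using opnorm_adj_hom_part_le[OF T, of "\<lambda>\<alpha>. complex_of_real (cmod (cnj (a \<alpha>)))" "Suc k"]
      by (intro order_trans[OF _ scaled]) simp_all
    note * = geometric_dominated[OF opnorm_nonneg[OF bounded_op_hom_part[OF Ti]] f]
      geometric_dominated[OF opnorm_nonneg[OF bounded_op_adj_hom_part[OF Ti]] g]
    show "summable ?g \<and> summable ?f \<and> suminf ?g + cmod (a []) + suminf ?f \<le> 1"
      using * by (simp add: d_def)
  qed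
  show "\<forall>r :: real ^ 'n. (\<forall>i. 0 \<le> r $ i) \<longrightarrow> norm r \<le> 1/2 \<longrightarrow>
        summable (\<lambda>k. \<Sum>\<alpha>\<in>words k. cmod (a \<alpha>) * word_scalar r \<alpha>) \<and>
        (\<Sum>k. \<Sum>\<alpha>\<in>words k. cmod (a \<alpha>) * word_scalar r \<alpha>) \<le> 1"
  proof (intro allI impI)
    fix r :: "real ^ 'n"
    assume r: "\<forall>i. 0 \<le> r $ i" "norm r \<le> 1/2"
    let ?f = "\<lambda>k. \<Sum>\<alpha>\<in>words k. cmod (a \<alpha>) * word_scalar r \<alpha>"
    have "?f (Suc k) \<le> d * (1/2) ^ Suc k" for k
    proof -
      have "?f (Suc k) \<le> d * norm r ^ Suc k"
        using sum_cmod_word_scalar_le(2)[of r a "Suc k"] r(1)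
        by (intro order_trans[OF _ scaled]) simp_all
      also have "\<dots> \<le> d * (1/2) ^ Suc k"
        using r(2) d by (intro mult_left_mono power_mono) auto
      finally show ?thesis .
    qed
    note * = geometric_dominated[where f = "\<lambda>k. ?f (Suc k)", OF sum_cmod_word_scalar_le(1)[OF spec[OF r(1)]] this]
    show "summable ?f \<and> suminf ?f \<le> 1"
      using * by (intro suminf_Suc_le) (simp_all add: d_def word_scalar_def)
  qed
  show "\<forall>r :: real ^ 'n. (\<forall>i. 0 \<le> r $ i) \<longrightarrow> norm r \<le> 1/3 \<longrightarrow>
        summable (\<lambda>k. \<Sum>\<alpha>\<in>words (Suc k). cmod (a \<alpha>) * word_scalar r \<alpha>) \<and>
        cmod (a []) + 2 * (\<Sum>k. \<Sum>\<alpha>\<in>words (Suc k). cmod (a \<alpha>) * word_scalar r \<alpha>) \<le> 1"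
  proof (intro allI impI)
    fix r :: "real ^ 'n"
    assume r: "\<forall>i. 0 \<le> r $ i" "norm r \<le> 1/3"
    let ?f = "\<lambda>k. \<Sum>\<alpha>\<in>words (Suc k). cmod (a \<alpha>) * word_scalar r \<alpha>"
    have "?f k \<le> d * (1/3) ^ Suc k" for k
    proof -
      have "?f k \<le> d * norm r ^ Suc k"
        using sum_cmod_word_scalar_le(2)[of r a "Suc k"] r(1)
        by (intro order_trans[OF _ scaled]) simp_all
      also have "\<dots> \<le> d * (1/3) ^ Suc k"
        using r(2) d by (intro mult_left_mono power_mono) auto
      finally show ?thesis .
    qed
    note * = geometric_dominated[where f = ?f, OF sum_cmod_word_scalar_le(1)[OF spec[OF r(1)]] this]
    show "summable ?f \<and> cmod (a []) + 2 * suminf ?f \<le> 1"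
      using * by (simp add: d_def)
  qed
qed

end
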